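(* Let $l\ge1$ be fixed and let $Q_{n,k}=\sum_{j\ge0}Q_{n,k,j}$, where $Q_{n,k,j}$ is the flag Eulerian quasisymmetric function described in the context. For integers $n\ge1$ and $a,b\geq1$ such that $a+b=ln$, $$\sum_{i=0}^{n-1}h_{i}\,Q_{n-i,a-1}=\sum_{i=0}^{n-1}h_i\,Q_{n-i,b-1},$$ where $h_i$ denotes the complete homogeneous symmetric function of degree $i$ (with $h_0=1$).
   Context: Fix a positive integer $l$ and commuting indeterminates $x_1,x_2,\dots$. Let $\mathcal{B}$ be the alphabet consisting of the letters $u^m$ ($u\in\{1,2,\dots\}$, $m\in\{0,1,\dots,l-1\}$) and the barred letters $\overline{u^0}$ ($u\in\{1,2,\dots\}$). The letter $u^m$ is called $m$-colored; $\overline{u^0}$ is called $0$-colored. The absolute value of $u^m$ and of $\overline{u^0}$ is $u$, and the weight of each is $x_u$. A colored necklace is a circular word over $\mathcal{B}$ (letters placed clockwise on a circle, up to rotation) which is primitive (the linear word is not a concatenation of at least two copies of a proper subword) and satisfies: (1) every barred letter is followed (clockwise) by a letter of lesser or equal absolute value; (2) every $0$-colored unbarred letter is followed by a letter of greater or equal absolute value; (3) a necklace of length one is not a single barred letter. A colored ornament is a finite multiset of colored necklaces; its weight $\mathrm{wt}(R)$ is the product of the weights of its letters. For $n,k,j\ge0$, $Q_{n,k,j}$ is the sum of $\mathrm{wt}(R)$ over all colored ornaments $R$ with $n$ letters in total, exactly $j$ necklaces consisting of a single letter of the form $u^0$, and with $l\cdot(\#\text{barred letters})+\sum_{m=1}^{l-1}m\cdot(\#\text{letters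 of the form }u^m)=k$. (By Hyatt's colored ornament interpretation this coincides with the paper's definition of the flag Eulerian quasisymmetric functions.) *)

theory Defs
  imports Main "HOL-Library.Multiset"
begin

text \<open>Letters of the alphabet B: Let u m is the letter u^m, Bar u is the barred letter (u^0 with bar).\<close>
datatype letter = Let nat nat | Bar nat

fun absv :: "letter \<Rightarrow> nat" where
  "absv (Let u m) = u"
| "absv (Bar u) = u"

fun is_bar :: "letter \<Rightarrow> bool" where
  "is_bar (Let u m) = False"
| "is_bar (Bar u) = True"

fun is_unbarred0 :: "letter \<Rightarrow> bool" where
  "is_unbarred0 (Let u m) = (m = 0)"
| "is_unbarred0 (Bar u) = False"

fun valid_letter :: "nat \<Rightarrow> letter \<Rightarrow> bool" where
  "valid_letter l (Let u m) = (1 \<le> u \<and> m < l)"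
| "valid_letter l (Bar u) = (1 \<le> u)"

fun kcontrib :: "nat \<Rightarrow> letter \<Rightarrow> nat" where
  "kcontrib l (Let u m) = m"
| "kcontrib l (Bar u) = l"

definition primitive :: "'a list \<Rightarrow> bool" where
  "primitive w \<longleftrightarrow> w \<noteq> [] \<and>
     \<not> (\<exists>v k. 2 \<le> k \<and> w = concat (replicate k v))"

text \<open>Linear representative w of a colored necklace (letters clockwise, the letter
  after position i is at position (i+1) mod length w).\<close>
definition necklace_word :: "nat \<Rightarrow> letter list \<Rightarrow> bool" where
  "necklace_word l w \<longleftrightarrow>
     w \<noteq> [] \<and> (\<forall>x\<in>set w. valid_letter l x) \<and> primitive w \<and>
     (\<forall>i<length w. is_bar (w ! i) \<longrightarrow>
          absv (w ! ((i + 1) mod length w)) \<le> absv (w ! i)) \<and>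
     (\<forall>i<length w. is_unbarred0 (w ! i) \<longrightarrow>
          absv (w ! i) \<le> absv (w ! ((i + 1) mod length w))) \<and>
     \<not> (length w = 1 \<and> is_bar (hd w))"

text \<open>A circular word = rotation class of a linear word.\<close>
definition rot_class :: "'a list \<Rightarrow> 'a list set" where
  "rot_class w = range (\<lambda>k. rotate k w)"

definition necklaces :: "nat \<Rightarrow> letter list set set" where
  "necklaces l = {rot_class w | w. necklace_word l w}"

text \<open>Multiset of letters of a necklace (independent of the chosen representative).\<close>
definition neck_letters :: "letter list set \<Rightarrow> letter multiset" where
  "neck_letters c = mset (SOME w. w \<in> c)"

definition ornament :: "nat \<Rightarrow> letter list set multiset \<Rightarrow> bool" where
  "ornament l R \<longleftrightarrow> (\<forall>c\<in>#R. c \<in> necklaces l)"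

definition orn_letters :: "letter list set multiset \<Rightarrow> letter multiset" where
  "orn_letters R = sum_mset (image_mset neck_letters R)"

text \<open>Weight of an ornament, as the monomial x^alpha encoded by the multiset alpha of
  variable indices.\<close>
definition orn_weight :: "letter list set multiset \<Rightarrow> nat multiset" where
  "orn_weight R = image_mset absv (orn_letters R)"

definition orn_k :: "nat \<Rightarrow> letter list set multiset \<Rightarrow> nat" where
  "orn_k l R = sum_mset (image_mset (kcontrib l) (orn_letters R))"

definition orn_j :: "letter list set multiset \<Rightarrow> nat" where
  "orn_j R = size (filter_mset (\<lambda>c. \<exists>u. c = {[Let u 0]}) R)"

text \<open>Formal power series in x_1, x_2, ... are represented by their coefficient
  functions: the value at alpha is the coefficient of the monomial prod_{u in# alpha} x_u.\<close>
type_synonym series = "nat multiset \<Rightarrow> int"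

definition Qnkj :: "nat \<Rightarrow> nat \<Rightarrow> nat \<Rightarrow> nat \<Rightarrow> series" where
  "Qnkj l n k j alpha = int (card {R. ornament l R \<and> size (orn_letters R) = n \<and>
        orn_j R = j \<and> orn_k l R = k \<and> orn_weight R = alpha})"

text \<open>Q_{n,k} = sum over j >= 0 of Q_{n,k,j}; Q_{n,k,j} = 0 for j > n
  (each such necklace uses a letter).\<close>
definition Qnk :: "nat \<Rightarrow> nat \<Rightarrow> nat \<Rightarrow> series" where
  "Qnk l n k alpha = (\<Sum>j\<le>n. Qnkj l n k j alpha)"

definition hcomp :: "nat \<Rightarrow> series" where
  "hcomp i alpha = (if size alpha = i \<and> 0 \<notin># alpha then 1 else 0)"

definition ser_mult :: "series \<Rightarrow> series \<Rightarrow> series" where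
  "ser_mult f g alpha = (\<Sum>beta\<in>{beta. beta \<subseteq># alpha}. f beta * g (alpha - beta))"

end

theory Submission
  imports Defs Complex_Main "HOL-Library.List_Lexorder"
begin

text \<open>
  Order the letters so that larger absolute values come first and the barred letter comes first
  among those of equal absolute value. Factorization into nonincreasing Lyndon words then identifies
  colored ornaments with words obeying the conditions (1) and (2) linearly, the last letter being
  followed by a letter of infinite absolute value. Let \<open>G(v)\<close> be the generating function (with \<open>t\<close>
  marking the statistic \<open>k\<close>) of the words that may be followed by absolute value \<open>v\<close>. Removing the last
  letter gives \<open>(1 - x\<^bsub>v+1\<^esub>) G(v+1) = (1 - t\<^sup>l x\<^sub>v) G(v)\<close> and \<open>G(0) - 1 = t (A - 1)\<close>, where \<open>A\<close> is
  \<open>G\<close> at infinity. With \<open>H = \<Sum> h\<^sub>i\<close> and \<open>H' = \<Sum> t\<^bsup>l i\<^esup> h\<^sub>i\<close> this telescopes to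
  \<open>H' A = H (1 - t + t A)\<close>. Replacing \<open>t\<close> by \<open>1/t\<close> and \<open>x\<^sub>u\<close> by \<open>t\<^sup>l x\<^sub>u\<close> exchanges \<open>H\<close> and \<open>H'\<close>,
  and the two equations together show that \<open>t H (A - 1)\<close> changes only by \<open>H' - H\<close> under this
  substitution, that is, only in the coefficients of \<open>t\<^sup>0\<close> and \<open>t\<^bsup>l n\<^esup>\<close>.
\<close>

section \<open>Lyndon words\<close>

lemma append_less_append_iff [simp]:
  fixes p x y :: "'a::linorder list"
  shows "p @ x < p @ y \<longleftrightarrow> x < y"
  by (induction p) auto

lemma le_append [simp]:
  fixes x y :: "'a::linorder list"
  shows "x \<le> x @ y"
  by (induction x) auto

text \<open>Either the smaller word is a proper prefix, or there is a first mismatch, and a mismatch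
  survives arbitrary extension of both words. Most comparisons of Lyndon words below reduce to this
  dichotomy.\<close>

lemma list_less_cases:
  fixes x y :: "'a::linorder list"
  assumes "x < y"
  obtains (prefix) z where "z \<noteq> []" "y = x @ z"
  | (mismatch) "\<And>a b. x @ a < y @ b"
proof -
  have "(\<exists>z. z \<noteq> [] \<and> y = x @ z) \<or> (\<forall>a b. x @ a < y @ b)"
    using assms
  proof (induction x arbitrary: y)
    case Nil
    then show ?case by (cases y) auto
  next
    case (Cons c x)
    then show ?case by (cases y) auto
  qed
  then show thesis using prefix mismatch by blast
qed

lemma append_less_append_same_length:
  fixes x y :: "'a::linorder list"
  assumes "x < y" "length x \<ge> length y"
  shows "x @ a < y @ b"
  using assms(1) by (cases rule: list_less_cases) (use assms(2) in auto)

text \<open>The suffix characterization serves as the definition. Its link with primitive words that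
  are least among their rotations is made by \<open>lyndon_less_rotation\<close>,
  \<open>lyndon_primitive\<close> and \<open>primitive_lyndon_rotation\<close>.\<close>

definition lyndon :: "'a::linorder list \<Rightarrow> bool" where
  "lyndon w \<longleftrightarrow> w \<noteq> [] \<and> (\<forall>p s. w = p @ s \<longrightarrow> p \<noteq> [] \<longrightarrow> s \<noteq> [] \<longrightarrow> w < s)"

lemma lyndon_nonempty: "lyndon w \<Longrightarrow> w \<noteq> []"
  by (simp add: lyndon_def)

lemma lyndon_less_suffix: "lyndon (p @ s) \<Longrightarrow> p \<noteq> [] \<Longrightarrow> s \<noteq> [] \<Longrightarrow> p @ s < s"
  by (simp add: lyndon_def)

lemma lyndon_le_suffix: "lyndon (p @ s) \<Longrightarrow> s \<noteq> [] \<Longrightarrow> p @ s \<le> s"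
  by (cases "p = []") (auto dest: lyndon_less_suffix)

lemma lyndon_singleton [simp]: "lyndon [x]"
  by (auto simp: lyndon_def Cons_eq_append_conv)

text \<open>First \<open>u @ v < v\<close>: either \<open>v = u @ z\<close>, and then
  \<open>v < z\<close>, or \<open>u\<close> and \<open>v\<close> mismatch. A suffix starting inside
  \<open>u\<close> is \<open>u' @ v\<close> with \<open>u < u'\<close> and \<open>u'\<close> no
  longer than \<open>u\<close>, so the inequality survives appending \<open>v\<close>. Any other
  suffix is a suffix of \<open>v\<close>, hence at least \<open>v\<close>.\<close>

lemma lyndon_append:
  fixes u v :: "'a::linorder list"
  assumes u: "lyndon u" and v: "lyndon v" and "u < v"
  shows "lyndon (u @ v)"
proof -
  have uv: "u @ v < v" using \<open>u < v\<close>
  proof (cases rule: list_less_cases)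
    case (prefix z)
    with v u have "v < z" by (metis lyndon_def)
    then show ?thesis using prefix by simp
  next
    case mismatch
    from this[of v "[]"] show ?thesis by simp
  qed
  have "u @ v < s" if eq: "u @ v = p @ s" and "p \<noteq> []" "s \<noteq> []" for p s
  proof (cases "length p < length u")
    case True
    define u' where "u' = drop (length p) u"
    have "take (length p) u = p" "s = u' @ v"
      using eq True unfolding u'_def by (auto simp: append_eq_append_conv_if)
    then have "u = p @ u'" "s = u' @ v"
      unfolding u'_def by (metis append_take_drop_id)+
    moreover have "u' \<noteq> []" using True unfolding u'_def by auto
    ultimately have "u < u'" using u \<open>p \<noteq> []\<close> lyndon_less_suffix by blast
    then have "u @ v < u' @ v"
      by (rule append_less_append_same_length) (simp add: u'_def)
    then show ?thesis using \<open>s = u' @ v\<close> by simp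
  next
    case False
    then obtain q where "v = q @ s"
      using eq by (auto simp: append_eq_append_conv_if)
    then show ?thesis using v uv \<open>s \<noteq> []\<close> lyndon_le_suffix by fastforce
  qed
  then show ?thesis using u by (auto simp: lyndon_def)
qed

lemma lyndon_less_rotation:
  fixes p s :: "'a::linorder list"
  assumes "lyndon (p @ s)" "p \<noteq> []" "s \<noteq> []"
  shows "p @ s < s @ p"
  using lyndon_less_suffix[OF assms] le_append less_le_trans by blast

text \<open>In a proper power the root \<open>v\<close> is both a prefix, so
  \<open>v \<le> w\<close>, and a proper suffix, so \<open>w < v\<close>.\<close>

lemma lyndon_primitive:
  fixes w :: "'a::linorder list"
  assumes "lyndon w"
  shows "primitive w"
proof -
  have False if k: "2 \<le> k" and w: "w = concat (replicate k v)" for v k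
  proof -
    obtain j where "k = Suc (Suc j)" using k by (metis add_2_eq_Suc le_Suc_ex)
    then have w1: "w = v @ concat (replicate (Suc j) v)"
      and w2: "w = concat (replicate (Suc j) v) @ v"
      using w by (simp_all add: replicate_append_same flip: concat_replicate_trivial)
         (metis append_assoc concat.simps(1,2) concat_append append_Nil2 replicate_append_same)
    have "v \<noteq> []" using lyndon_nonempty[OF assms] w by auto
    then have "w < v" using w2 assms lyndon_less_suffix[of "concat (replicate (Suc j) v)" v] by auto
    moreover have "v \<le> w" using w1 by simp
    ultimately show False by simp
  qed
  then show ?thesis using lyndon_nonempty[OF assms] by (auto simp: primitive_def)
qed

lemma rotate_eq_append:
  obtains p s where "w = p @ s" "rotate k w = s @ p"
  by (metis append_take_drop_id rotate_drop_take)

text \<open>If \<open>p @ s\<close> and \<open>s @ p\<close> are both Lyndon with \<open>p\<close>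
  and \<open>s\<close> nonempty, each is smaller than the other.\<close>

lemma lyndon_rotation_unique:
  fixes w :: "'a::linorder list"
  assumes "lyndon w" "lyndon (rotate k w)"
  shows "rotate k w = w"
proof -
  obtain p s where ps: "w = p @ s" "rotate k w = s @ p" by (rule rotate_eq_append)
  show ?thesis
  proof (cases "p = [] \<or> s = []")
    case False
    then have "p @ s < s @ p" "s @ p < p @ s"
      using lyndon_less_rotation assms ps by metis+
    then show ?thesis by simp
  next
    case True
    then show ?thesis unfolding ps(2) unfolding ps(1) by auto
  qed
qed

section \<open>Lyndon rotations of primitive words\<close>

lemma primitive_append_commute:
  assumes "primitive (p @ s)" "p @ s = s @ p"
  shows "p = [] \<or> s = []"
proof (rule ccontr)
  assume "\<not> (p = [] \<or> s = [])"
  then have "p \<noteq> []" "s \<noteq> []" by auto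
  from comm_append_are_replicate[OF assms(2)] obtain m n z where
    mn: "concat (replicate m z) = p" "concat (replicate n z) = s" by blast
  then have "m \<noteq> 0" "n \<noteq> 0" using \<open>p \<noteq> []\<close> \<open>s \<noteq> []\<close> by auto
  then have "2 \<le> m + n" by simp
  moreover have "p @ s = concat (replicate (m + n) z)"
    using mn by (simp add: replicate_add)
  ultimately show False using assms(1) unfolding primitive_def by blast
qed

lemma rotate1_concat_replicate:
  "rotate1 (concat (replicate k v)) = concat (replicate k (rotate1 v))"
proof (cases v)
  case (Cons x u)
  have "concat (replicate k (x # u)) @ [x] = x # concat (replicate k (u @ [x]))"
    by (induction k) auto
  then show ?thesis using Cons by (cases k) auto
qed simp

lemma rotate_concat_replicate:
  "rotate m (concat (replicate k v)) = concat (replicate k (rotate m v))"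
  by (induction m) (simp_all add: rotate1_concat_replicate)

lemma primitive_swap:
  assumes "primitive (p @ s)"
  shows "primitive (s @ p)"
proof -
  have "p @ s = concat (replicate k (rotate (length s) v))" if "s @ p = concat (replicate k v)" for k v
    by (metis that rotate_append rotate_concat_replicate)
  then show ?thesis using assms unfolding primitive_def by blast
qed

text \<open>The least rotation \<open>m = p @ s\<close> works. Suppose \<open>s < m\<close>. A
  mismatch would give \<open>s @ p < m\<close>. Otherwise \<open>m = s @ q\<close>; primitivity
  makes \<open>m < s @ p\<close> strict, so \<open>q < p\<close> with equal lengths, and the
  rotation \<open>q @ s\<close> is smaller than \<open>m\<close>.\<close>

lemma primitive_lyndon_rotation:
  fixes w :: "'a::linorder list"
  assumes "primitive w"
  obtains k where "lyndon (rotate k w)"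
proof -
  have ne: "w \<noteq> []" using assms by (simp add: primitive_def)
  have fin: "finite (range (\<lambda>k. rotate k w))"
  proof (rule finite_subset)
    show "range (\<lambda>k. rotate k w) \<subseteq> (\<lambda>k. rotate k w) ` {..<length w}"
      using ne by (metis (no_types, lifting) image_subsetI imageI length_greater_0_conv lessThan_iff mod_less_divisor rotate_conv_mod)
  qed simp
  define m where "m = Min (range (\<lambda>k. rotate k w))"
  have "m \<in> range (\<lambda>k. rotate k w)" unfolding m_def by (rule Min_in) (use fin in auto)
  then obtain k where k: "m = rotate k w" by blast
  have min: "m \<le> rotate j w" for j unfolding m_def by (rule Min_le) (use fin in auto)
  have prim: "primitive m"
    using assms primitive_swap k by (metis rotate_eq_append)
  have rot: "m \<le> s @ p" if "m = p @ s" for p s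
    by (metis k min that rotate_append rotate_rotate)
  have "m < s" if eq: "m = p @ s" and "p \<noteq> []" "s \<noteq> []" for p s
  proof (rule ccontr)
    assume "\<not> m < s"
    moreover have "s \<noteq> m" using eq \<open>p \<noteq> []\<close> by auto
    ultimately have "s < m" by simp
    have "m \<noteq> s @ p" using primitive_append_commute[of p s] prim eq that by auto
    then have less: "m < s @ p" using rot[OF eq] by simp
    from \<open>s < m\<close> show False
    proof (cases rule: list_less_cases)
      case (prefix q)
      then have "q < p" using less by (metis append_less_append_iff)
      moreover have "length q = length p"
        using prefix eq by (metis add_left_cancel length_append add.commute)
      ultimately have "q @ s < m" using eq append_less_append_same_length by fastforce
      then show False using rot[OF prefix(2)] by simp
    next
      case mismatch
      from this[of p "[]"] less show False by simp
    qed
  qed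
  then have "lyndon m" using prim by (auto simp: lyndon_def primitive_def)
  then show thesis using that k by simp
qed

section \<open>Existence and uniqueness of the Lyndon factorization\<close>

definition lyndon_fact :: "'a::linorder list list \<Rightarrow> bool" where
  "lyndon_fact ws \<longleftrightarrow> sorted_wrt (\<ge>) ws \<and> (\<forall>w\<in>set ws. lyndon w)"

lemma lyndon_fact_Nil [simp]: "lyndon_fact []"
  by (simp add: lyndon_fact_def)

lemma lyndon_fact_Cons:
  "lyndon_fact (w # ws) \<longleftrightarrow> lyndon w \<and> (\<forall>v\<in>set ws. v \<le> w) \<and> lyndon_fact ws"
  by (auto simp: lyndon_fact_def)

text \<open>As long as \<open>u\<close> is smaller than the first factor, the two merge into a
  longer Lyndon word by \<open>lyndon_append\<close>; otherwise \<open>u\<close> itself becomes the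
  first factor.\<close>

lemma lyndon_fact_extend:
  assumes "lyndon u" "lyndon_fact ws"
  shows "\<exists>vs. lyndon_fact vs \<and> concat vs = u @ concat ws"
  using assms
proof (induction ws arbitrary: u)
  case Nil
  then show ?case by (intro exI[of _ "[u]"]) (simp add: lyndon_fact_def)
next
  case (Cons w ws)
  show ?case
  proof (cases "u < w")
    case True
    then have "lyndon (u @ w)" using Cons.prems lyndon_append by (auto simp: lyndon_fact_Cons)
    then show ?thesis using Cons.IH[of "u @ w"] Cons.prems by (auto simp: lyndon_fact_Cons)
  next
    case False
    then have "lyndon_fact (u # w # ws)" using Cons.prems by (auto simp: lyndon_fact_Cons)
    then show ?thesis by (intro exI[of _ "u # w # ws"]) simp
  qed
qed

lemma lyndon_fact_exists: "\<exists>ws. lyndon_fact ws \<and> concat ws = w"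
proof (induction w)
  case Nil
  show ?case by (intro exI[of _ "[]"]) simp
next
  case (Cons x w)
  then obtain ws where "lyndon_fact ws" "concat ws = w" by blast
  then show ?case using lyndon_fact_extend[of "[x]" ws] by simp
qed

text \<open>A Lyndon prefix longer than the first factor would end inside a later factor, and its part
  there would be a suffix not exceeding the prefix.\<close>

lemma lyndon_fact_longest_prefix:
  fixes w :: "'a::linorder list"
  assumes fact: "lyndon_fact (w # ws)" and p: "lyndon p" and eq: "p @ t = w @ concat ws"
  shows "length p \<le> length w"
proof (rule ccontr)
  assume "\<not> length p \<le> length w"
  define r where "r = drop (length w) p"
  have "take (length w) p = w" "r \<noteq> []"
    using eq \<open>\<not> length p \<le> length w\<close> by (auto simp: append_eq_append_conv_if r_def)
  then have r: "p = w @ r" "r \<noteq> []"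
    unfolding r_def by (metis append_take_drop_id)+
  have "\<exists>q s v. r = q @ s \<and> s \<noteq> [] \<and> v \<in> set ws \<and> s \<le> v"
  proof -
    have "r @ t = concat ws" using r eq by simp
    then show ?thesis using \<open>r \<noteq> []\<close>
    proof (induction ws arbitrary: r)
      case (Cons v ws)
      show ?case
      proof (cases "length r \<le> length v")
        case True
        then have "v = r @ drop (length r) v" using Cons.prems
          by (auto simp: append_eq_append_conv_if) (metis append_take_drop_id)
        then have "r \<le> v" by (metis le_append)
        then show ?thesis using Cons.prems by (intro exI[of _ "[]"] exI[of _ r] exI[of _ v]) auto
      next
        case False
        define r' where "r' = drop (length v) r"
        have r': "r = v @ r'" "r' @ t = concat ws" "r' \<noteq> []" using Cons.prems False
          unfolding r'_def by (simp_all add: append_eq_append_conv_if)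
            (metis append_take_drop_id)
        with Cons.IH[of r'] obtain q s v' where "r' = q @ s" "s \<noteq> []" "v' \<in> set ws" "s \<le> v'"
          by blast
        then show ?thesis using r'
          by (intro exI[of _ "v @ q"] exI[of _ s] exI[of _ v']) auto
      qed
    qed simp
  qed
  then obtain q s v where s: "r = q @ s" "s \<noteq> []" "v \<in> set ws" "s \<le> v" by blast
  have "w \<noteq> []" using fact by (simp add: lyndon_fact_Cons lyndon_nonempty)
  then have "p < s" using p r s lyndon_less_suffix[of "w @ q" s] by auto
  moreover have "s \<le> w" using s fact by (auto simp: lyndon_fact_Cons)
  moreover have "w \<le> p" using r by simp
  ultimately show False by simp
qed

text \<open>By \<open>lyndon_fact_longest_prefix\<close> the first factor is the longest Lyndon
  prefix of the word, so it is determined by the concatenation.\<close>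

lemma lyndon_fact_unique:
  fixes ws :: "'a::linorder list list"
  assumes "lyndon_fact ws" "lyndon_fact vs" "concat ws = concat vs"
  shows "ws = vs"
  using assms
proof (induction ws arbitrary: vs)
  case Nil
  then have "\<forall>v\<in>set vs. v = []" "\<forall>v\<in>set vs. v \<noteq> []"
    by (simp_all add: lyndon_fact_def lyndon_nonempty)
  then show ?case by (cases vs) auto
next
  case (Cons w ws)
  have "w \<noteq> []" using Cons.prems(1) by (simp add: lyndon_fact_Cons lyndon_nonempty)
  then obtain v vs' where vs: "vs = v # vs'" using Cons.prems(3) by (cases vs) simp_all
  have eq: "w @ concat ws = v @ concat vs'" using Cons.prems vs by simp
  have "lyndon w" "lyndon v" using Cons.prems vs by (auto simp: lyndon_fact_Cons)
  then have "length w = length v"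
    using lyndon_fact_longest_prefix[of w ws v "concat vs'"]
      lyndon_fact_longest_prefix[of v vs' w "concat ws"] Cons.prems(1,2) vs eq by simp
  then have "w = v" "concat ws = concat vs'" using eq by simp_all
  then show ?case using Cons.IH[of vs'] Cons.prems(1,2) vs by (simp add: lyndon_fact_Cons)
qed

section \<open>Ornaments and linear words\<close>

text \<open>Letters of larger absolute value come first and, among those of equal absolute value, the
  barred one does. In this order a Lyndon word starts with a letter of maximal absolute value and,
  unless it has length one, does not end with a barred letter of this absolute value.\<close>

instantiation letter :: linorder
begin

fun rank :: "letter \<Rightarrow> nat" where
  "rank (Bar u) = 0"
| "rank (Let u m) = Suc m"

definition "x \<le> y \<longleftrightarrow> absv y < absv x \<or> absv y = absv x \<and> rank x \<le> rank y"
definition "x < y \<longleftrightarrow> absv y < absv x \<or> absv y = absv x \<and> rank x < rank y"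

lemma letter_eqI: "absv x = absv y \<Longrightarrow> rank x = rank y \<Longrightarrow> x = y"
  by (cases x; cases y) auto

instance
  by standard (auto simp: less_eq_letter_def less_letter_def intro: letter_eqI)

end

section \<open>Local conditions on linear and circular words\<close>

definition follow_ok :: "letter \<Rightarrow> nat \<Rightarrow> bool" where
  "follow_ok x v \<longleftrightarrow> (is_bar x \<longrightarrow> v \<le> absv x) \<and> (is_unbarred0 x \<longrightarrow> absv x \<le> v)"

text \<open>The parameter \<open>v\<close> is the absolute value taken to follow the last letter.
  The absolute value of the first letter closes the word to a circle; a value above all those
  occurring plays the role of infinity.\<close>

fun admissible :: "letter list \<Rightarrow> nat \<Rightarrow> bool" where
  "admissible [] v = True"
| "admissible (x # xs) v = (follow_ok x (if xs = [] then v else absv (hd xs)) \<and> admissible xs v)"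

lemma admissible_append:
  "s \<noteq> [] \<Longrightarrow> admissible (p @ s) v \<longleftrightarrow> admissible p (absv (hd s)) \<and> admissible s v"
  by (induction p) auto

lemma admissible_iff_nth:
  "admissible w v \<longleftrightarrow>
    (\<forall>i<length w. follow_ok (w ! i) (if i + 1 < length w then absv (w ! (i + 1)) else v))"
proof (induction w)
  case (Cons x w)
  then show ?case by (cases w) (auto simp: All_less_Suc2)
qed simp

definition circular_admissible :: "letter list \<Rightarrow> bool" where
  "circular_admissible w \<longleftrightarrow> w \<noteq> [] \<and> admissible w (absv (hd w)) \<and> (\<nexists>u. w = [Bar u])"

lemma necklace_word_iff:
  "necklace_word l w \<longleftrightarrow> (\<forall>x\<in>set w. valid_letter l x) \<and> primitive w \<and> circular_admissible w"
proof (cases "w = []")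
  case False
  have "w ! ((i + 1) mod length w) = (if i + 1 < length w then w ! (i + 1) else hd w)"
    if "i < length w" for i
  proof (cases "i + 1 < length w")
    case False
    then have "i + 1 = length w" using that by simp
    then show ?thesis using \<open>w \<noteq> []\<close> by (simp add: hd_conv_nth)
  qed simp
  then have "admissible w (absv (hd w)) \<longleftrightarrow>
      (\<forall>i<length w. follow_ok (w ! i) (absv (w ! ((i + 1) mod length w))))"
    unfolding admissible_iff_nth by (intro all_cong) auto
  moreover have "length w = 1 \<and> is_bar (hd w) \<longleftrightarrow> (\<exists>u. w = [Bar u])"
    by (auto simp: length_Suc_conv elim: is_bar.elims(2))
  ultimately show ?thesis using False
    unfolding necklace_word_def circular_admissible_def follow_ok_def by blast
qed (simp add: necklace_word_def circular_admissible_def)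

lemma circular_admissible_swap:
  assumes "circular_admissible (p @ s)"
  shows "circular_admissible (s @ p)"
proof (cases "p = [] \<or> s = []")
  case False
  then show ?thesis using assms
    by (auto simp: circular_admissible_def admissible_append append_eq_Cons_conv)
qed (use assms in auto)

lemma necklace_word_swap: "necklace_word l (p @ s) \<Longrightarrow> necklace_word l (s @ p)"
  using primitive_swap circular_admissible_swap unfolding necklace_word_iff by fastforce

lemma necklace_word_rotate: "necklace_word l w \<Longrightarrow> necklace_word l (rotate k w)"
  by (metis necklace_word_swap rotate_eq_append)

lemma lyndon_hd_le_last:
  assumes "lyndon w"
  shows "hd w \<le> last w"
proof -
  have "w = butlast w @ [last w]" using lyndon_nonempty[OF assms] by simp
  then have "w \<le> [last w]" using assms lyndon_le_suffix by (metis not_Cons_self2)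
  then show ?thesis using lyndon_nonempty[OF assms] by (cases w) auto
qed

text \<open>Otherwise \<open>[last w]\<close> is a proper suffix, and \<open>w < [last w]\<close> is
  impossible for a word with the same first letter.\<close>

lemma lyndon_hd_eq_last:
  assumes "lyndon w" "hd w = last w"
  shows "w = [last w]"
proof (rule ccontr)
  assume neq: "w \<noteq> [last w]"
  have ne: "w \<noteq> []" using lyndon_nonempty[OF assms(1)] .
  then have "butlast w \<noteq> []" using neq by (metis append_butlast_last_id append_Nil)
  then have "w < [last w]" using assms ne lyndon_less_suffix[of "butlast w" "[last w]"] by simp
  then show False using ne assms(2) by (cases w) auto
qed

lemma Bar_minimal: "absv x = u \<Longrightarrow> x \<le> Bar u \<Longrightarrow> x = Bar u"
  by (cases x) (auto simp: less_eq_letter_def)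

text \<open>Each factor of the Lyndon factorization starts with an absolute value at most that of the
  next one, so replacing the successor of its last letter (the next factor) by its own first letter
  does not affect the local condition, apart from singletons \<open>[Bar u]\<close>.\<close>

lemma admissible_concat_iff:
  assumes "lyndon_fact ws" "\<And>w x. w \<in> set ws \<Longrightarrow> x \<in> set w \<Longrightarrow> absv x < v"
  shows "admissible (concat ws) v \<longleftrightarrow> (\<forall>w\<in>set ws. circular_admissible w)"
  using assms
proof (induction ws)
  case (Cons w ws)
  \<comment> \<open>The absolute value that follows \<open>w\<close> inside the
    concatenation.\<close>
  define n where "n = (if ws = [] then v else absv (hd (hd ws)))"
  have w: "lyndon w" "w \<noteq> []" and ws: "lyndon_fact ws" and le: "\<And>w'. w' \<in> set ws \<Longrightarrow> w' \<le> w"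
    using Cons.prems by (auto simp: lyndon_fact_Cons lyndon_nonempty)
  have IH: "admissible (concat ws) v \<longleftrightarrow> (\<forall>w\<in>set ws. circular_admissible w)"
    using Cons ws by auto
  have hd_ne: "hd ws \<noteq> []" if "ws \<noteq> []"
    using that ws by (cases ws) (auto simp: lyndon_fact_Cons lyndon_nonempty)
  have "admissible (concat (w # ws)) v \<longleftrightarrow> admissible w n \<and> admissible (concat ws) v"
  proof (cases ws)
    case (Cons w' ws')
    then have "w' \<noteq> []" using hd_ne by simp
    then show ?thesis using admissible_append[of "concat ws" w v] Cons by (simp add: n_def)
  qed (simp add: n_def)
  moreover have hd_le: "hd w' \<le> hd w" if "ws = w' # ws'" for w' ws'
    using le[of w'] hd_ne w(2) that by (cases w; cases w') auto
  have le_n: "absv (hd w) \<le> n"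
  proof (cases ws)
    case Nil
    then show ?thesis using Cons.prems(2)[of w "hd w"] w by (auto simp: n_def)
  next
    case (Cons w' ws')
    then show ?thesis using hd_le[OF Cons] by (auto simp: n_def less_eq_letter_def)
  qed
  obtain w0 x where wx: "w = w0 @ [x]" using w(2) by (metis append_butlast_last_id)
  then have x_le: "absv x \<le> absv (hd w)" and hd_le_x: "hd w \<le> x"
    using lyndon_hd_le_last[OF w(1)] by (auto simp: less_eq_letter_def)
  \<comment> \<open>Only the last letter \<open>x\<close> of \<open>w\<close> sees a difference
    between the successors \<open>n\<close> and \<open>absv (hd w)\<close>. An unbarred
    \<open>x\<close> is fine with both, since
    \<open>absv x \<le> absv (hd w) \<le> n\<close>.\<close>
  have "(admissible w n \<and> (\<forall>w\<in>set ws. circular_admissible w)) \<longleftrightarrow>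
        (circular_admissible w \<and> (\<forall>w\<in>set ws. circular_admissible w))"
  proof (cases x)
    case (Let u m)
    then show ?thesis using wx x_le le_n
      by (auto simp: circular_admissible_def admissible_append follow_ok_def)
  next
    case (Bar u)
    \<comment> \<open>A final barred letter of maximal absolute value is also the least possible
      first letter, so first and last letter coincide and \<open>w\<close> is a singleton.\<close>
    have single: "w = [Bar u]" if "absv (hd w) \<le> u"
    proof -
      have "absv (hd w) = u" using that x_le Bar by simp
      then have "hd w = Bar u" by (rule Bar_minimal) (use hd_le_x Bar in simp)
      then show ?thesis using lyndon_hd_eq_last[OF w(1)] wx Bar by auto
    qed
    have "\<not> circular_admissible w"
      using single wx Bar by (auto simp: circular_admissible_def admissible_append follow_ok_def)
    \<comment> \<open>A final barred letter on the linear side forces \<open>w = [Bar u]\<close>.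
      The next factor then starts with \<open>Bar u\<close> and is at most \<open>[Bar u]\<close>,
      so it is the forbidden singleton too; if there is no next factor, \<open>n = v\<close> exceeds
      \<open>u\<close>.\<close>
    moreover have False if adm: "admissible w n" and circ: "\<forall>w\<in>set ws. circular_admissible w"
    proof -
      have "n \<le> u" using adm wx Bar by (simp add: admissible_append follow_ok_def)
      then have sw: "w = [Bar u]" using le_n single by simp
      show False
      proof (cases ws)
        case Nil
        then show False using Cons.prems(2)[of w "Bar u"] sw \<open>n \<le> u\<close> by (simp add: n_def)
      next
        case (Cons w' ws')
        have "absv (hd w') = u" using \<open>n \<le> u\<close> le_n sw Cons by (simp add: n_def)
        moreover have "hd w' \<le> Bar u" using hd_le[OF Cons] sw by simp
        ultimately have "hd w' = Bar u" by (rule Bar_minimal)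
        moreover have "w' \<le> [Bar u]" "w' \<noteq> []" using le sw Cons hd_ne by auto
        ultimately have "w' = [Bar u]" by (cases w') auto
        then show False using circ Cons by (auto simp: circular_admissible_def)
      qed
    qed
    ultimately show ?thesis by blast
  qed
  ultimately show ?case using IH by auto
qed simp

section \<open>Bijections from ornaments to linear words\<close>

definition lyndon_necklaces :: "nat \<Rightarrow> letter list set" where
  "lyndon_necklaces l = {w. lyndon w \<and> necklace_word l w}"

lemma rot_class_rotate: "rot_class (rotate k w) = rot_class w"
proof -
  have "rotate j w \<in> rot_class (rotate k w)" for j
  proof (cases "w = []")
    case False
    obtain i where "(i + k) mod length w = j mod length w"
    proof
      \<comment> \<open>Adding the multiple \<open>k * length w\<close> keeps the subtraction of
        \<open>k\<close> from being truncated at zero.\<close>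
      show "(j + k * length w - k + k) mod length w = j mod length w"
        using False by (simp add: mult_le_mono2[of 1 "length w" k, simplified] Suc_le_eq trans_le_add2)
    qed
    then have "rotate j w = rotate i (rotate k w)" by (metis rotate_conv_mod rotate_rotate)
    then show ?thesis by (auto simp: rot_class_def)
  qed (simp add: rot_class_def)
  then show ?thesis by (auto simp: rot_class_def rotate_rotate)
qed

text \<open>Every rotation class of a necklace contains exactly one Lyndon word: uniqueness gives
  injectivity, existence gives surjectivity.\<close>

lemma bij_betw_rot_class: "bij_betw rot_class (lyndon_necklaces l) (necklaces l)"
proof (rule bij_betw_imageI)
  show "inj_on rot_class (lyndon_necklaces l)"
  proof
    fix v w assume v: "v \<in> lyndon_necklaces l" and w: "w \<in> lyndon_necklaces l"
      and eq: "rot_class v = rot_class w"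
    have "v \<in> rot_class v" unfolding rot_class_def by (metis rangeI rotate0 id_apply)
    then obtain k where "v = rotate k w" using eq by (auto simp: rot_class_def)
    then show "v = w" using lyndon_rotation_unique v w by (auto simp: lyndon_necklaces_def)
  qed
  show "rot_class ` lyndon_necklaces l = necklaces l"
  proof
    show "necklaces l \<subseteq> rot_class ` lyndon_necklaces l"
    proof
      fix c assume "c \<in> necklaces l"
      then obtain w where w: "c = rot_class w" "necklace_word l w" by (auto simp: necklaces_def)
      then obtain k where "lyndon (rotate k w)"
        using primitive_lyndon_rotation by (auto simp: necklace_word_iff)
      then have "rotate k w \<in> lyndon_necklaces l"
        using necklace_word_rotate w by (simp add: lyndon_necklaces_def)
      then show "c \<in> rot_class ` lyndon_necklaces l" using w rot_class_rotate by (metis imageI)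
    qed
  qed (auto simp: lyndon_necklaces_def necklaces_def)
qed

lemma neck_letters_rot_class [simp]: "neck_letters (rot_class w) = mset w"
proof -
  have "w \<in> rot_class w" unfolding rot_class_def by (metis rangeI rotate0 id_apply)
  then have "(SOME v. v \<in> rot_class w) \<in> rot_class w" by (rule someI)
  then obtain k where "(SOME v. v \<in> rot_class w) = rotate k w" by (auto simp: rot_class_def)
  moreover have "mset (rotate k w) = mset w" by (metis mset_append rotate_eq_append union_commute)
  ultimately show ?thesis unfolding neck_letters_def by simp
qed

lemma orn_letters_image_rot_class:
  "orn_letters (image_mset rot_class (mset ws)) = mset (concat ws)"
  by (induction ws) (auto simp: orn_letters_def)

lemma inj_on_image_mset_lists:
  assumes "inj_on f A" "image_mset f M = image_mset f N" "set_mset M \<subseteq> A" "set_mset N \<subseteq> A"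
  shows "M = N"
proof -
  have "image_mset (the_inv_into A f) (image_mset f K) = K" if "set_mset K \<subseteq> A" for K
    using that assms(1) by (auto simp: multiset.map_comp the_inv_into_f_f intro!: multiset.map_ident_strong)
  then show ?thesis using assms by metis
qed

text \<open>A finite multiset of Lyndon words is encoded by its unique nonincreasing listing, which
  is the form taken by Lyndon factorizations.\<close>

lemma bij_betw_lyndon_facts_ornaments:
  "bij_betw (\<lambda>ws. image_mset rot_class (mset ws))
    {ws. sorted_wrt (\<ge>) ws \<and> set ws \<subseteq> lyndon_necklaces l} {R. ornament l R}"
proof (rule bij_betw_imageI)
  have inj: "inj_on rot_class (lyndon_necklaces l)"
    and surj: "rot_class ` lyndon_necklaces l = necklaces l"
    using bij_betw_rot_class[of l] by (auto simp: bij_betw_def)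
  show "inj_on (\<lambda>ws. image_mset rot_class (mset ws))
    {ws. sorted_wrt (\<ge>) ws \<and> set ws \<subseteq> lyndon_necklaces l}"
  proof
    fix ws vs
    assume "ws \<in> {ws. sorted_wrt (\<ge>) ws \<and> set ws \<subseteq> lyndon_necklaces l}"
      and "vs \<in> {ws. sorted_wrt (\<ge>) ws \<and> set ws \<subseteq> lyndon_necklaces l}"
      and "image_mset rot_class (mset ws) = image_mset rot_class (mset vs)"
    then have "mset ws = mset vs" "sorted (rev ws)" "sorted (rev vs)"
      using inj_on_image_mset_lists[OF inj, of "mset ws" "mset vs"]
      by (auto simp: sorted_wrt_rev)
    then have "rev ws = rev vs" by (metis mset_rev properties_for_sort sorted_sort_id)
    then show "ws = vs" by simp
  qed
  show "(\<lambda>ws. image_mset rot_class (mset ws)) `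
      {ws. sorted_wrt (\<ge>) ws \<and> set ws \<subseteq> lyndon_necklaces l} = {R. ornament l R}"
  proof
    show "{R. ornament l R} \<subseteq> (\<lambda>ws. image_mset rot_class (mset ws)) `
      {ws. sorted_wrt (\<ge>) ws \<and> set ws \<subseteq> lyndon_necklaces l}"
    proof
      fix R assume "R \<in> {R. ornament l R}"
      then have R: "set_mset R \<subseteq> rot_class ` lyndon_necklaces l"
        using surj by (auto simp: ornament_def)
      define g where "g = the_inv_into (lyndon_necklaces l) rot_class"
      define ws where "ws = rev (sorted_list_of_multiset (image_mset g R))"
      have g: "g c \<in> lyndon_necklaces l" "rot_class (g c) = c" if "c \<in># R" for c
        using that R inj unfolding g_def
        by (auto intro!: the_inv_into_into f_the_inv_into_f)
      have "image_mset rot_class (mset ws) = R"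
        using g(2) by (auto simp: ws_def multiset.map_comp intro!: multiset.map_ident_strong)
      moreover have "sorted_wrt (\<ge>) ws" unfolding ws_def
        using sorted_sorted_list_of_multiset[of "image_mset g R"] by (simp add: sorted_wrt_rev)
      moreover have "set ws \<subseteq> lyndon_necklaces l" using g(1) by (auto simp: ws_def)
      ultimately show "R \<in> (\<lambda>ws. image_mset rot_class (mset ws)) `
        {ws. sorted_wrt (\<ge>) ws \<and> set ws \<subseteq> lyndon_necklaces l}" by (auto intro!: image_eqI[of _ _ ws])
    qed
  qed (auto simp: ornament_def intro!: imageI simp flip: surj)
qed

lemma bij_betw_lyndon_facts_words:
  "bij_betw concat
    {ws. sorted_wrt (\<ge>) ws \<and> set ws \<subseteq> lyndon_necklaces l \<and> (\<forall>x\<in>set (concat ws). absv x < v)}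
    {w. (\<forall>x\<in>set w. valid_letter l x \<and> absv x < v) \<and> admissible w v}"
  (is "bij_betw concat ?F ?W")
proof (rule bij_betw_imageI)
  have fact: "lyndon_fact ws" if "ws \<in> ?F" for ws
    using that by (auto simp: lyndon_fact_def lyndon_necklaces_def)
  show "inj_on concat ?F" by (intro inj_onI lyndon_fact_unique fact)
  show "concat ` ?F = ?W"
  proof (intro set_eqI iffI)
    fix w assume "w \<in> concat ` ?F"
    then obtain ws where ws: "ws \<in> ?F" "w = concat ws" by blast
    then have "admissible (concat ws) v"
      using fact by (subst admissible_concat_iff) (auto simp: lyndon_necklaces_def necklace_word_iff)
    then show "w \<in> ?W" using ws by (auto simp: lyndon_necklaces_def necklace_word_iff)
  next
    fix w assume w: "w \<in> ?W"
    obtain ws where ws: "lyndon_fact ws" "concat ws = w" using lyndon_fact_exists by blast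
    have "\<forall>u\<in>set ws. circular_admissible u"
      using w ws admissible_concat_iff[of ws v] by auto
    then have "ws \<in> ?F" using w ws
      by (auto simp: lyndon_fact_def lyndon_necklaces_def necklace_word_iff lyndon_primitive)
    then show "w \<in> concat ` ?F" using ws by blast
  qed
qed

text \<open>Both bijections preserve the multiset of letters, so they restrict to the objects whose
  letters satisfy \<open>P\<close>. The bound \<open>v\<close> on absolute values makes
  \<open>admissible_concat_iff\<close> applicable.\<close>

lemma card_ornaments:
  assumes "\<And>M. P M \<Longrightarrow> \<forall>x\<in>#M. absv x < v"
  shows "card {R. ornament l R \<and> P (orn_letters R)} =
    card {w. (\<forall>x\<in>set w. valid_letter l x) \<and> admissible w v \<and> P (mset w)}"
    and "finite {w. (\<forall>x\<in>set w. valid_letter l x) \<and> admissible w v \<and> P (mset w)} \<Longrightarrow>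
      finite {R. ornament l R \<and> P (orn_letters R)}"
proof -
  define F where "F = {ws. sorted_wrt (\<ge>) ws \<and> set ws \<subseteq> lyndon_necklaces l \<and> P (mset (concat ws))}"
  have bound: "absv x < v" if "P (mset (concat ws))" "w \<in> set ws" "x \<in> set w" for ws w x
    using assms[OF that(1)] that(2,3) by auto
  have "bij_betw (\<lambda>ws. image_mset rot_class (mset ws)) F
    ((\<lambda>ws. image_mset rot_class (mset ws)) ` F)"
    by (rule bij_betw_subset[OF bij_betw_lyndon_facts_ornaments[of l]]) (auto simp: F_def)
  moreover have "(\<lambda>ws. image_mset rot_class (mset ws)) ` F = {R. ornament l R \<and> P (orn_letters R)}"
  proof -
    have "{R. ornament l R \<and> P (orn_letters R)} = {R \<in> (\<lambda>ws. image_mset rot_class (mset ws)) `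
      {ws. sorted_wrt (\<ge>) ws \<and> set ws \<subseteq> lyndon_necklaces l}. P (orn_letters R)}"
      using bij_betw_lyndon_facts_ornaments[of l] by (auto simp: bij_betw_def)
    then show ?thesis by (auto simp: F_def orn_letters_image_rot_class)
  qed
  ultimately have R: "bij_betw (\<lambda>ws. image_mset rot_class (mset ws)) F
    {R. ornament l R \<and> P (orn_letters R)}" by simp
  have "bij_betw concat F (concat ` F)"
    by (rule bij_betw_subset[OF bij_betw_lyndon_facts_words[of l v]]) (use bound in \<open>auto simp: F_def\<close>)
  moreover have "concat ` F = {w. (\<forall>x\<in>set w. valid_letter l x) \<and> admissible w v \<and> P (mset w)}"
  proof -
    have "{w. (\<forall>x\<in>set w. valid_letter l x) \<and> admissible w v \<and> P (mset w)} =
      {w \<in> {w. (\<forall>x\<in>set w. valid_letter l x \<and> absv x < v) \<and> admissible w v}. P (mset w)}"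
      using assms by auto
    also have "\<dots> = {w \<in> concat ` {ws. sorted_wrt (\<ge>) ws \<and> set ws \<subseteq> lyndon_necklaces l \<and>
        (\<forall>x\<in>set (concat ws). absv x < v)}. P (mset w)}"
      using bij_betw_lyndon_facts_words[of l v] by (simp add: bij_betw_def)
    also have "\<dots> = concat ` F" using assms by (fastforce simp: F_def)
    finally show ?thesis ..
  qed
  ultimately have W: "bij_betw concat F
    {w. (\<forall>x\<in>set w. valid_letter l x) \<and> admissible w v \<and> P (mset w)}" by simp
  show "card {R. ornament l R \<and> P (orn_letters R)} =
    card {w. (\<forall>x\<in>set w. valid_letter l x) \<and> admissible w v \<and> P (mset w)}"
    using bij_betw_same_card[OF R] bij_betw_same_card[OF W] by simp
  show "finite {R. ornament l R \<and> P (orn_letters R)}"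
    if "finite {w. (\<forall>x\<in>set w. valid_letter l x) \<and> admissible w v \<and> P (mset w)}"
    using that bij_betw_finite[OF R] bij_betw_finite[OF W] by simp
qed

section \<open>Coefficients of \<open>Qnk\<close> as word counts\<close>

definition words :: "nat \<Rightarrow> nat \<Rightarrow> nat multiset \<Rightarrow> letter list set" where
  "words l v g = {w. (\<forall>x\<in>set w. valid_letter l x) \<and> admissible w v \<and> image_mset absv (mset w) = g}"

definition letters_over :: "nat \<Rightarrow> nat \<Rightarrow> letter set" where
  "letters_over l u = insert (Bar u) (Let u ` {..<l})"

definition word_k :: "nat \<Rightarrow> letter list \<Rightarrow> nat" where
  "word_k l w = sum_list (map (kcontrib l) w)"

lemma finite_letters_over [simp]: "finite (letters_over l u)"
  by (simp add: letters_over_def)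

lemma letters_over_iff: "x \<in> letters_over l u \<and> 1 \<le> u \<longleftrightarrow> valid_letter l x \<and> absv x = u"
  by (cases x) (auto simp: letters_over_def)

lemma finite_words [simp]: "finite (words l v g)"
proof (rule finite_subset)
  show "words l v g \<subseteq> {w. set w \<subseteq> (\<Union>u\<in>set_mset g. letters_over l u) \<and> length w = size g}"
    using letters_over_iff by (fastforce simp: words_def)
qed (simp add: finite_lists_length_eq)

lemma words_empty [simp]: "words l v {#} = {[]}"
  by (auto simp: words_def)

lemma words_zero: "0 \<in># g \<Longrightarrow> words l v g = {}"
proof -
  have "absv x \<noteq> 0" if "valid_letter l x" for x
    using that by (cases x) auto
  then show "0 \<in># g \<Longrightarrow> words l v g = {}" by (fastforce simp: words_def)
qed

lemma card_ornaments_weight: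
  assumes "\<forall>u\<in>#g. u < v"
  shows "card {R. ornament l R \<and> orn_k l R = k \<and> orn_weight R = g} =
      card {w \<in> words l v g. word_k l w = k}"
    and "finite {R. ornament l R \<and> orn_k l R = k \<and> orn_weight R = g}"
proof -
  define P where "P M \<longleftrightarrow> sum_mset (image_mset (kcontrib l) M) = k \<and> image_mset absv M = g" for M
  have P: "P M \<Longrightarrow> \<forall>x\<in>#M. absv x < v" for M
    using assms by (auto simp: P_def)
  have R: "{R. ornament l R \<and> orn_k l R = k \<and> orn_weight R = g} = {R. ornament l R \<and> P (orn_letters R)}"
    by (simp add: P_def orn_k_def orn_weight_def)
  have W: "{w. (\<forall>x\<in>set w. valid_letter l x) \<and> admissible w v \<and> P (mset w)} =
      {w \<in> words l v g. word_k l w = k}"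
    by (auto simp: P_def words_def word_k_def simp flip: sum_mset_sum_list mset_map)
  show "card {R. ornament l R \<and> orn_k l R = k \<and> orn_weight R = g} =
      card {w \<in> words l v g. word_k l w = k}"
    using card_ornaments(1)[of P v l, OF P] unfolding R W by blast
  show "finite {R. ornament l R \<and> orn_k l R = k \<and> orn_weight R = g}"
    using card_ornaments(2)[of P v l, OF P] unfolding R W by simp
qed

lemma neck_letters_nonempty:
  assumes "c \<in> necklaces l"
  shows "neck_letters c \<noteq> {#}"
  using assms by (auto simp: necklaces_def necklace_word_def)

text \<open>Every necklace has at least one letter. Hence the truncation \<open>j \<le> n\<close> in
  \<open>Qnk\<close> loses no ornament with \<open>n\<close> letters.\<close>

lemma orn_j_le:
  assumes "ornament l R"
  shows "orn_j R \<le> size (orn_letters R)"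
proof -
  have "size R \<le> size (orn_letters R)" using assms
  proof (induction R)
    case (add c R)
    then have "1 \<le> size (neck_letters c)"
      using neck_letters_nonempty by (auto simp: ornament_def Suc_le_eq nonempty_has_size)
    then show ?case using add by (auto simp: ornament_def orn_letters_def)
  qed (simp add: orn_letters_def)
  then show ?thesis unfolding orn_j_def by (meson size_filter_mset_lesseq le_trans)
qed

lemma Qnk_eq_card_words:
  assumes "\<forall>u\<in>#g. u < v"
  shows "Qnk l n k g = (if size g = n then int (card {w \<in> words l v g. word_k l w = k}) else 0)"
proof (cases "size g = n")
  case True
  define O1 where "O1 = {R. ornament l R \<and> orn_k l R = k \<and> orn_weight R = g}"
  have fin: "finite O1" unfolding O1_def by (rule card_ornaments_weight(2)[OF assms])
  have size: "size (orn_letters R) = n" if "R \<in> O1" for R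
    using that True by (auto simp: O1_def orn_weight_def)
  have "Qnk l n k g = (\<Sum>j\<le>n. int (card {R \<in> O1. orn_j R = j}))"
    unfolding Qnk_def Qnkj_def
    by (intro sum.cong refl arg_cong[of _ _ int] arg_cong[of _ _ card])
       (use size in \<open>auto simp: O1_def\<close>)
  also have "\<dots> = int (card (\<Union>j\<in>{..n}. {R \<in> O1. orn_j R = j}))"
    using fin by (subst card_UN_disjoint) auto
  also have "(\<Union>j\<in>{..n}. {R \<in> O1. orn_j R = j}) = O1"
    using size orn_j_le by (fastforce simp: O1_def)
  finally show ?thesis using True card_ornaments_weight(1)[OF assms] by (simp add: O1_def)
next
  case False
  then have empty: "{R. ornament l R \<and> size (orn_letters R) = n \<and> orn_j R = j \<and> orn_k l R = k \<and> orn_weight R = g} = {}"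
    for j by (auto simp: orn_weight_def)
  show ?thesis using False unfolding Qnk_def Qnkj_def empty by simp
qed

section \<open>Power series in commuting variables\<close>

typedef ('v, 'a) mseries = "UNIV :: ('v multiset \<Rightarrow> 'a) set"
  morphisms mcoeff Abs_mseries ..

lemma mcoeff_Abs [simp]: "mcoeff (Abs_mseries f) = f"
  by (simp add: Abs_mseries_inverse)

lemma mseries_eqI: "(\<And>g. mcoeff f g = mcoeff h g) \<Longrightarrow> f = h"
  by (metis ext mcoeff_inject)

lemma finite_subset_mset [simp]: "finite {B. B \<subseteq># (A :: 'v multiset)}"
proof (rule finite_subset)
  show "{B. B \<subseteq># A} \<subseteq> mset ` {xs. set xs \<subseteq> set_mset A \<and> length xs \<le> size A}"
  proof
    fix B assume "B \<in> {B. B \<subseteq># A}"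
    moreover obtain xs where "B = mset xs" by (metis ex_mset)
    ultimately show "B \<in> mset ` {xs. set xs \<subseteq> set_mset A \<and> length xs \<le> size A}"
      using set_mset_mono size_mset_mono by fastforce
  qed
qed (simp add: finite_lists_length_le)

lemma finite_sum_eq_mset [simp]: "finite {(B, C). B + C = (A :: 'v multiset)}"
proof (rule finite_subset)
  show "{(B, C). B + C = A} \<subseteq> {B. B \<subseteq># A} \<times> {B. B \<subseteq># A}" by auto
qed (intro finite_cartesian_product finite_subset_mset)

text \<open>Indexing products by pairs makes commutativity and associativity mere
  reindexings.\<close>

lemma sum_submultisets_eq:
  fixes A :: "'v multiset"
  shows "(\<Sum>B\<in>{B. B \<subseteq># A}. f B (A - B)) = (\<Sum>(B, C)\<in>{(B, C). B + C = A}. f B C)"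
  by (rule sum.reindex_bij_witness[of _ fst "\<lambda>B. (B, A - B)"]) auto

instantiation mseries :: (type, comm_ring_1) comm_ring_1
begin

definition "0 = Abs_mseries (\<lambda>_. 0)"
definition "1 = Abs_mseries (\<lambda>g. if g = {#} then 1 else 0)"
definition "f + h = Abs_mseries (\<lambda>g. mcoeff f g + mcoeff h g)"
definition "- f = Abs_mseries (\<lambda>g. - mcoeff f g)"
definition "f - h = Abs_mseries (\<lambda>g. mcoeff f g - mcoeff h g)"
definition "f * h = Abs_mseries (\<lambda>g. \<Sum>B\<in>{B. B \<subseteq># g}. mcoeff f B * mcoeff h (g - B))"

lemma mcoeff_zero [simp]: "mcoeff 0 g = 0"
  and mcoeff_one: "mcoeff 1 g = (if g = {#} then 1 else 0)"
  and mcoeff_add [simp]: "mcoeff (f + h) g = mcoeff f g + mcoeff h g"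
  and mcoeff_uminus [simp]: "mcoeff (- f) g = - mcoeff f g"
  and mcoeff_diff [simp]: "mcoeff (f - h) g = mcoeff f g - mcoeff h g"
  and mcoeff_mult: "mcoeff (f * h) g = (\<Sum>B\<in>{B. B \<subseteq># g}. mcoeff f B * mcoeff h (g - B))"
  by (simp_all add: zero_mseries_def one_mseries_def plus_mseries_def uminus_mseries_def
      minus_mseries_def times_mseries_def)

lemma mcoeff_mult_pairs:
  "mcoeff (f * h) g = (\<Sum>(B, C)\<in>{(B, C). B + C = g}. mcoeff f B * mcoeff h C)"
  unfolding mcoeff_mult by (rule sum_submultisets_eq)

instance
proof
  fix a b c :: "('a, 'b) mseries"
  have "mcoeff (a * b * c) g = mcoeff (a * (b * c)) g" for g
  proof -
    have "mcoeff (a * b * c) g =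
      (\<Sum>x\<in>{(D, E). D + E = g}. \<Sum>y\<in>{(B, C). B + C = fst x}.
        mcoeff a (fst y) * mcoeff b (snd y) * mcoeff c (snd x))"
      unfolding mcoeff_mult_pairs case_prod_unfold sum_distrib_right ..
    also have "\<dots> = (\<Sum>(x, y)\<in>(SIGMA x:{(D, E). D + E = g}. {(B, C). B + C = fst x}).
        mcoeff a (fst y) * mcoeff b (snd y) * mcoeff c (snd x))"
      by (subst sum.Sigma) auto
    \<comment> \<open>Both nested sums run over the ordered triples of multisets with sum
      \<open>g\<close>, bracketed differently.\<close>
    also have "\<dots> = (\<Sum>(x, y)\<in>(SIGMA x:{(D, E). D + E = g}. {(B, C). B + C = snd x}).
        mcoeff a (fst x) * (mcoeff b (fst y) * mcoeff c (snd y)))"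
      by (rule sum.reindex_bij_witness[of _
            "\<lambda>((B, D), (C, E)). ((B + C, E), (B, C))" "\<lambda>((D, E), (B, C)). ((B, C + E), (C, E))"])
         (auto simp: ac_simps)
    also have "\<dots> = (\<Sum>x\<in>{(D, E). D + E = g}. \<Sum>y\<in>{(B, C). B + C = snd x}.
        mcoeff a (fst x) * (mcoeff b (fst y) * mcoeff c (snd y)))"
      by (subst sum.Sigma) auto
    also have "\<dots> = mcoeff (a * (b * c)) g"
      unfolding mcoeff_mult_pairs case_prod_unfold sum_distrib_left ..
    finally show ?thesis .
  qed
  then show "a * b * c = a * (b * c)" by (rule mseries_eqI)
  have "mcoeff (a * b) g = mcoeff (b * a) g" for g
    unfolding mcoeff_mult_pairs
    by (rule sum.reindex_bij_witness[of _ prod.swap prod.swap]) (auto simp: ac_simps)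
  then show "a * b = b * a" by (rule mseries_eqI)
  have "mcoeff (1 * a) g = mcoeff a g" for g
  proof -
    have "mcoeff (1 * a) g = (\<Sum>B\<in>{B. B \<subseteq># g}. if B = {#} then mcoeff a g else 0)"
      unfolding mcoeff_mult by (intro sum.cong) (auto simp: mcoeff_one)
    then show ?thesis by simp
  qed
  then show "1 * a = a" by (rule mseries_eqI)
  show "(a + b) * c = a * c + b * c"
    by (rule mseries_eqI) (simp add: mcoeff_mult distrib_right sum.distrib)
  have "mcoeff (0 :: ('a, 'b) mseries) {#} \<noteq> mcoeff 1 {#}" by (simp add: mcoeff_one)
  then show "(0 :: ('a, 'b) mseries) \<noteq> 1" by metis
qed (auto intro!: mseries_eqI)

end

lemma mcoeff_sum [simp]: "mcoeff (sum f S) g = (\<Sum>s\<in>S. mcoeff (f s) g)"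
  by (induction S rule: infinite_finite_induct) auto

section \<open>Constants, variables, scaling and complete series\<close>

definition mconst :: "'a::comm_ring_1 \<Rightarrow> ('v, 'a) mseries" where
  "mconst c = Abs_mseries (\<lambda>g. if g = {#} then c else 0)"

definition mvar :: "'v \<Rightarrow> ('v, 'a::comm_ring_1) mseries" where
  "mvar u = Abs_mseries (\<lambda>g. if g = {#u#} then 1 else 0)"

text \<open>The substitution of \<open>c x\<^sub>u\<close> for every variable \<open>x\<^sub>u\<close>.\<close>

definition mscale :: "'a \<Rightarrow> ('v, 'a::comm_ring_1) mseries \<Rightarrow> ('v, 'a) mseries" where
  "mscale c f = Abs_mseries (\<lambda>g. c ^ size g * mcoeff f g)"

lemma mcoeff_mconst: "mcoeff (mconst c) g = (if g = {#} then c else 0)"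
  by (simp add: mconst_def)

lemma mcoeff_mscale [simp]: "mcoeff (mscale c f) g = c ^ size g * mcoeff f g"
  by (simp add: mscale_def)

lemma mcoeff_mconst_mult [simp]: "mcoeff (mconst c * f) g = c * mcoeff f g"
proof -
  have "mcoeff (mconst c * f) g = (\<Sum>B\<in>{B. B \<subseteq># g}. if B = {#} then c * mcoeff f g else 0)"
    unfolding mcoeff_mult by (intro sum.cong) (auto simp: mcoeff_mconst)
  then show ?thesis by simp
qed

lemma mcoeff_mvar_mult:
  "mcoeff (mvar u * f) g = (if u \<in># g then mcoeff f (g - {#u#}) else 0)"
proof -
  have "mcoeff (mvar u * f) g =
      (\<Sum>B\<in>{B. B \<subseteq># g}. if B = {#u#} then mcoeff f (g - {#u#}) else 0)"
    unfolding mcoeff_mult by (intro sum.cong) (auto simp: mvar_def)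
  then show ?thesis by simp
qed

lemma mconst_1 [simp]: "mconst 1 = 1"
  by (rule mseries_eqI) (simp add: mcoeff_mconst mcoeff_one)

lemma mconst_diff: "mconst (c - d) = mconst c - mconst d"
  and mconst_mult: "mconst (c * d) = mconst c * mconst d"
  by (rule mseries_eqI; simp add: mcoeff_mconst)+

lemma mscale_mult: "mscale c (f * h) = mscale c f * mscale c h"
proof (rule mseries_eqI)
  fix g
  have "mcoeff (mscale c (f * h)) g = (\<Sum>(B, C)\<in>{(B, C). B + C = g}. c ^ size g * (mcoeff f B * mcoeff h C))"
    by (simp add: mcoeff_mult_pairs sum_distrib_left case_prod_unfold)
  also have "\<dots> = mcoeff (mscale c f * mscale c h) g"
    unfolding mcoeff_mult_pairs by (intro sum.cong) (auto simp: power_add ac_simps)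
  finally show "mcoeff (mscale c (f * h)) g = mcoeff (mscale c f * mscale c h) g" .
qed

lemma mscale_diff: "mscale c (f - h) = mscale c f - mscale c h"
  by (rule mseries_eqI) (simp add: algebra_simps)

lemma mscale_add: "mscale c (f + h) = mscale c f + mscale c h"
  by (rule mseries_eqI) (simp add: algebra_simps)

lemma mscale_1 [simp]: "mscale c 1 = 1"
  by (rule mseries_eqI) (simp add: mcoeff_one)

lemma mscale_mconst [simp]: "mscale c (mconst d) = mconst d"
  by (rule mseries_eqI) (simp add: mcoeff_mconst)

text \<open>By induction on the degree: once the coefficients of \<open>h\<close> of smaller degree
  vanish, the coefficient of \<open>f * h\<close> at \<open>g\<close> is the constant term of
  \<open>f\<close> times that of \<open>h\<close> at \<open>g\<close>.\<close>

lemma mseries_mult_eq_0D: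
  fixes f h :: "('v, 'a::idom) mseries"
  assumes "f * h = 0" "mcoeff f {#} \<noteq> 0"
  shows "h = 0"
proof (rule mseries_eqI)
  fix g
  show "mcoeff h g = mcoeff 0 g"
  proof (induction "size g" arbitrary: g rule: less_induct)
    case less
    have "mcoeff f B * mcoeff h (g - B) = (if B = {#} then mcoeff f {#} * mcoeff h g else 0)"
      if "B \<subseteq># g" for B
    proof (cases "B = {#}")
      case False
      then have "size (g - B) < size g"
        using that by (simp add: size_Diff_submset nonempty_has_size) (metis size_mset_mono diff_less nonempty_has_size le_zero_eq neq0_conv)
      then show ?thesis using less False by simp
    qed simp
    then have "mcoeff (f * h) g = (\<Sum>B\<in>{B. B \<subseteq># g}. if B = {#} then mcoeff f {#} * mcoeff h g else 0)"
      unfolding mcoeff_mult by (intro sum.cong) auto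
    then show ?case using assms by simp
  qed
qed

text \<open>\<open>\<Sum>\<^sub>i c\<^sup>i h\<^sub>i\<close> in the variables \<open>x\<^sub>u\<close> with \<open>u \<in> S\<close>.\<close>

definition mcomplete :: "'v set \<Rightarrow> 'a \<Rightarrow> ('v, 'a::comm_ring_1) mseries" where
  "mcomplete S c = Abs_mseries (\<lambda>g. if set_mset g \<subseteq> S then c ^ size g else 0)"

lemma mcoeff_mcomplete: "mcoeff (mcomplete S c) g = (if set_mset g \<subseteq> S then c ^ size g else 0)"
  by (simp add: mcomplete_def)

lemma mscale_mcomplete: "mscale c (mcomplete S d) = mcomplete S (c * d)"
  by (rule mseries_eqI) (simp add: mcoeff_mcomplete power_mult_distrib)

text \<open>Geometric series in the new variable: monomials containing \<open>u\<close> cancel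
  against the same monomials with one \<open>u\<close> removed.\<close>

lemma mcomplete_insert:
  assumes "u \<notin> S"
  shows "mcomplete (insert u S) c * (1 - mconst c * mvar u) = mcomplete S c"
proof (rule mseries_eqI)
  fix g
  have "mcoeff (mcomplete (insert u S) c * (1 - mconst c * mvar u)) g =
    mcoeff (mcomplete (insert u S) c) g - mcoeff (mconst c * (mvar u * mcomplete (insert u S) c)) g"
    by (simp add: algebra_simps)
  also have "\<dots> = mcoeff (mcomplete S c) g"
  proof (cases "u \<in># g")
    case True
    then obtain g' where "g = add_mset u g'" by (metis insert_DiffM)
    then show ?thesis using assms by (auto simp: mcoeff_mcomplete mcoeff_mvar_mult)
  qed (auto simp: mcoeff_mcomplete mcoeff_mvar_mult)
  finally show "mcoeff (mcomplete (insert u S) c * (1 - mconst c * mvar u)) g = mcoeff (mcomplete S c) g" .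
qed

lemma mcomplete_mult_prod:
  assumes "finite S"
  shows "mcomplete S c * (\<Prod>u\<in>S. 1 - mconst c * mvar u) = 1"
  using assms
proof (induction S)
  case empty
  show ?case by (rule mseries_eqI) (simp add: mcoeff_mcomplete mcoeff_one)
next
  case (insert u S)
  then show ?case using mcomplete_insert[of u S c] by (simp flip: mult.assoc)
qed

section \<open>The generating function of linear words\<close>

text \<open>The indeterminate \<open>t\<close> is specialized to a real number \<open>q\<close>, so
  that \<open>1 / q\<close> is available. Coefficients of powers of \<open>t\<close> are recovered
  later from infinitely many values of \<open>q\<close>.\<close>

definition word_gf :: "real \<Rightarrow> nat \<Rightarrow> nat \<Rightarrow> nat multiset \<Rightarrow> real" where
  "word_gf q l v g = (\<Sum>w\<in>words l v g. q ^ word_k l w)"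

text \<open>The total weight of the letters of absolute value \<open>u\<close> that may be followed
  by \<open>v\<close>, as \<open>sum_letters_over\<close> shows: the barred letter, the 0-colored
  unbarred one, and the remaining colors, which are unrestricted.\<close>

definition transfer :: "real \<Rightarrow> nat \<Rightarrow> nat \<Rightarrow> nat \<Rightarrow> real" where
  "transfer q l u v = (if v \<le> u then q ^ l else 0) + (if u \<le> v then 1 else 0) + (\<Sum>m=1..<l. q ^ m)"

lemma sum_letters_over:
  assumes "1 \<le> l"
  shows "(\<Sum>x\<in>{x \<in> letters_over l u. follow_ok x v}. q ^ kcontrib l x) = transfer q l u v"
proof -
  have "(\<Sum>x\<in>{x \<in> letters_over l u. follow_ok x v}. q ^ kcontrib l x) =
      (\<Sum>x\<in>letters_over l u. if follow_ok x v then q ^ kcontrib l x else 0)"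
    by (simp add: sum.If_cases Int_def)
  also have "\<dots> = (if v \<le> u then q ^ l else 0) + (\<Sum>m<l. if follow_ok (Let u m) v then q ^ m else 0)"
    unfolding letters_over_def
    by (subst sum.insert) (auto simp: sum.reindex inj_on_def follow_ok_def intro!: sum.cong)
  also have "{..<l} = insert 0 {1..<l}" using assms by auto
  also have "(\<Sum>m\<in>insert 0 {1..<l}. if follow_ok (Let u m) v then q ^ m else 0) =
      (if u \<le> v then 1 else 0) + (\<Sum>m=1..<l. q ^ m)"
    by (subst sum.insert) (auto simp: follow_ok_def intro!: sum.cong)
  finally show ?thesis by (simp add: transfer_def)
qed

text \<open>Split off the last letter: its absolute value \<open>u\<close> becomes the value
  following the rest of the word.\<close>

lemma word_gf_rec:
  assumes "1 \<le> l" "g \<noteq> {#}" "0 \<notin># g"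
  shows "word_gf q l v g = (\<Sum>u\<in>set_mset g. transfer q l u v * word_gf q l u (g - {#u#}))"
proof -
  have "word_gf q l v g =
    (\<Sum>(u, x, w)\<in>(SIGMA u:set_mset g. {x \<in> letters_over l u. follow_ok x v} \<times> words l u (g - {#u#})).
      q ^ kcontrib l x * q ^ word_k l w)"
    unfolding word_gf_def
  proof (rule sum.reindex_bij_witness[of _ "\<lambda>(u, x, w). w @ [x]" "\<lambda>w. (absv (last w), last w, butlast w)"])
    fix w assume "w \<in> words l v g"
    moreover from this have "w \<noteq> []" using assms(2) by (auto simp: words_def)
    then obtain w' x where "w = w' @ [x]" by (metis append_butlast_last_id)
    ultimately show "(case (absv (last w), last w, butlast w) of (u, x, w) \<Rightarrow> w @ [x]) = w"
      and "(absv (last w), last w, butlast w) \<in>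
        (SIGMA u:set_mset g. {x \<in> letters_over l u. follow_ok x v} \<times> words l u (g - {#u#}))"
      and "(case (absv (last w), last w, butlast w) of (u, x, w) \<Rightarrow> q ^ kcontrib l x * q ^ word_k l w) =
        q ^ word_k l w"
      using letters_over_iff[of x l "absv x"]
      by (auto simp: words_def admissible_append word_k_def power_add mult.commute)
  next
    fix t assume t: "t \<in> (SIGMA u:set_mset g. {x \<in> letters_over l u. follow_ok x v} \<times> words l u (g - {#u#}))"
    obtain u x w where uxw: "t = (u, x, w)" by (cases t)
    have "u \<in># g" using t uxw by auto
    moreover from this have "u \<noteq> 0" using assms(3) by metis
    ultimately have u: "1 \<le> u" "u \<in># g" by simp_all
    then have "absv x = u" "valid_letter l x" using letters_over_iff[of x l u] t uxw by auto
    then show "(case (case t of (u, x, w) \<Rightarrow> w @ [x]) of w \<Rightarrow> (absv (last w), last w, butlast w)) = t"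
      and "(case t of (u, x, w) \<Rightarrow> w @ [x]) \<in> words l v g"
      using t uxw u by (auto simp: words_def admissible_append)
  qed
  also have "\<dots> = (\<Sum>u\<in>set_mset g. \<Sum>(x, w)\<in>{x \<in> letters_over l u. follow_ok x v} \<times> words l u (g - {#u#}).
      q ^ kcontrib l x * q ^ word_k l w)"
    by (subst sum.Sigma) auto
  also have "\<dots> = (\<Sum>u\<in>set_mset g. transfer q l u v * word_gf q l u (g - {#u#}))"
    unfolding sum_letters_over[OF assms(1), symmetric] word_gf_def
    by (simp add: sum_product sum.cartesian_product)
  finally show ?thesis .
qed

text \<open>Cutting down to the variables with indices in \<open>{1..U}\<close> makes the sums and
  products over variables finite.\<close>

definition word_series :: "nat \<Rightarrow> real \<Rightarrow> nat \<Rightarrow> nat \<Rightarrow> (nat, real) mseries" where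
  "word_series U q l v = Abs_mseries (\<lambda>g. if set_mset g \<subseteq> {1..U} then word_gf q l v g else 0)"

lemma word_series_rec:
  assumes "1 \<le> l"
  shows "word_series U q l v =
    1 + (\<Sum>u=1..U. mconst (transfer q l u v) * (mvar u * word_series U q l u))"
proof (rule mseries_eqI)
  fix g :: "nat multiset"
  have "(\<Sum>u=1..U. transfer q l u v * (if u \<in># g then mcoeff (word_series U q l u) (g - {#u#}) else 0))
      = (\<Sum>u\<in>set_mset g. transfer q l u v * word_gf q l u (g - {#u#}))" if g: "set_mset g \<subseteq> {1..U}"
  proof (rule sum.mono_neutral_cong_right)
    fix u assume "u \<in># g"
    then show "transfer q l u v * (if u \<in># g then mcoeff (word_series U q l u) (g - {#u#}) else 0) =
        transfer q l u v * word_gf q l u (g - {#u#})"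
      using g by (auto simp: word_series_def dest: in_diffD)
  qed (use g in auto)
  moreover have "(\<Sum>u=1..U. transfer q l u v * (if u \<in># g then mcoeff (word_series U q l u) (g - {#u#}) else 0)) = 0"
    if g: "\<not> set_mset g \<subseteq> {1..U}"
  proof (rule sum.neutral, rule ballI)
    fix u assume "u \<in> {1..U}"
    then have "\<not> set_mset (g - {#u#}) \<subseteq> {1..U}" if "u \<in># g"
      using g by (metis insert_DiffM insert_subset set_mset_add_mset_insert that)
    then show "transfer q l u v * (if u \<in># g then mcoeff (word_series U q l u) (g - {#u#}) else 0) = 0"
      by (simp add: word_series_def)
  qed
  moreover have "mcoeff (word_series U q l v) g =
      (if set_mset g \<subseteq> {1..U} then word_gf q l v g else 0)" by (simp add: word_series_def)
  moreover have "word_gf q l v g = (\<Sum>u\<in>set_mset g. transfer q l u v * word_gf q l u (g - {#u#}))"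
    if "g \<noteq> {#}" "set_mset g \<subseteq> {1..U}"
  proof (rule word_gf_rec[OF assms that(1)])
    show "0 \<notin># g" using that(2) by auto
  qed
  moreover have "word_gf q l v {#} = 1" by (simp add: word_gf_def word_k_def)
  ultimately show "mcoeff (word_series U q l v) g =
      mcoeff (1 + (\<Sum>u=1..U. mconst (transfer q l u v) * (mvar u * word_series U q l u))) g"
    by (cases "g = {#}") (auto simp: mcoeff_one mcoeff_mvar_mult)
qed

text \<open>Setting variables outside the range to zero keeps the recursion in \<open>v\<close>
  uniform, including \<open>v = 0\<close> and \<open>v = U\<close>.\<close>

definition mvar_upto :: "nat \<Rightarrow> nat \<Rightarrow> (nat, real) mseries" where
  "mvar_upto U u = (if u \<in> {1..U} then mvar u else 0)"

text \<open>Raising the following value from \<open>v\<close> to \<open>v + 1\<close> changes the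
  allowed last letters in two places only: the 0-colored unbarred letter of absolute value
  \<open>v + 1\<close> becomes allowed, and the barred letter of absolute value \<open>v\<close> is
  lost.\<close>

lemma word_series_Suc:
  assumes "1 \<le> l"
  shows "(1 - mvar_upto U (Suc v)) * word_series U q l (Suc v) =
    (1 - mconst (q ^ l) * mvar_upto U v) * word_series U q l v"
proof -
  define W where "W = word_series U q l"
  have d: "transfer q l u (Suc v) - transfer q l u v =
      (if u = Suc v then 1 else 0) - (if u = v then q ^ l else 0)" for u
    by (auto simp: transfer_def)
  have "W (Suc v) - W v = (\<Sum>u=1..U. mconst (transfer q l u (Suc v) - transfer q l u v) * (mvar u * W u))"
    unfolding W_def word_series_rec[OF assms, of U q "Suc v"] word_series_rec[OF assms, of U q v]
    by (simp add: mconst_diff left_diff_distrib sum_subtractf)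
  also have "\<dots> = (\<Sum>u=1..U. (if u = Suc v then mvar u * W u else 0) -
      (if u = v then mconst (q ^ l) * (mvar u * W u) else 0))"
    unfolding d by (intro sum.cong refl mseries_eqI) auto
  also have "\<dots> = mvar_upto U (Suc v) * W (Suc v) - mconst (q ^ l) * (mvar_upto U v * W v)"
    by (simp add: sum_subtractf mvar_upto_def)
  finally show ?thesis by (simp add: W_def algebra_simps)
qed

lemma word_series_product:
  assumes "1 \<le> l"
  shows "word_series U q l v * (\<Prod>u=1..v. 1 - mvar_upto U u) =
    (\<Prod>u=1..<v. 1 - mconst (q ^ l) * mvar_upto U u) * word_series U q l 0"
proof (induction v)
  case (Suc v)
  have X0: "mvar_upto U 0 = 0" by (simp add: mvar_upto_def)
  \<comment> \<open>For \<open>v = 0\<close> the new factor has index 0 and equals 1, because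
    \<open>mvar_upto U 0 = 0\<close>.\<close>
  have split: "(\<Prod>u=1..<Suc v. 1 - mconst (q ^ l) * mvar_upto U u) =
      (1 - mconst (q ^ l) * mvar_upto U v) * (\<Prod>u=1..<v. 1 - mconst (q ^ l) * mvar_upto U u)"
    by (cases v) (simp_all add: X0 mult.commute)
  have "word_series U q l (Suc v) * (\<Prod>u=1..Suc v. 1 - mvar_upto U u) =
      ((1 - mvar_upto U (Suc v)) * word_series U q l (Suc v)) * (\<Prod>u=1..v. 1 - mvar_upto U u)"
    by (simp add: ac_simps)
  also have "\<dots> = (1 - mconst (q ^ l) * mvar_upto U v) * (word_series U q l v * (\<Prod>u=1..v. 1 - mvar_upto U u))"
    using word_series_Suc[OF assms, of U v q] by (simp add: ac_simps)
  finally show ?case unfolding Suc.IH split by (simp add: ac_simps)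
qed simp

text \<open>Before the value 0 the last letter has total weight \<open>q + ... + q ^ l\<close>,
  before \<open>U + 1\<close> it has \<open>1 + ... + q ^ (l - 1)\<close>; these differ by the
  factor \<open>q\<close>.\<close>

lemma word_series_zero:
  assumes "1 \<le> l"
  shows "word_series U q l 0 = 1 - mconst q + mconst q * word_series U q l (Suc U)"
proof -
  have "transfer q l u 0 = q * transfer q l u (Suc U)" if "u \<in> {1..U}" for u
  proof -
    have "q * (1 + (\<Sum>m=1..<l. q ^ m)) = q * (\<Sum>m<l. q ^ m)"
      using assms by (simp add: sum.atLeast1_atMost_eq lessThan_atLeast0 sum.atLeast_Suc_lessThan)
    also have "\<dots> = (\<Sum>m=1..<Suc l. q ^ m)"
      by (simp add: sum_distrib_left sum.shift_bounds_Suc_ivl lessThan_atLeast0 del: sum.op_ivl_Suc)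
    also have "\<dots> = q ^ l + (\<Sum>m=1..<l. q ^ m)" using assms by simp
    finally show ?thesis using that by (simp add: transfer_def)
  qed
  then have "(\<Sum>u=1..U. mconst (transfer q l u 0) * (mvar u * word_series U q l u)) =
      mconst q * (\<Sum>u=1..U. mconst (transfer q l u (Suc U)) * (mvar u * word_series U q l u))"
    unfolding sum_distrib_left by (intro sum.cong refl) (simp add: mconst_mult mult.assoc)
  then show ?thesis
    using word_series_rec[OF assms, of U q 0] word_series_rec[OF assms, of U q "Suc U"]
    by (simp add: algebra_simps)
qed

text \<open>Telescope from 0 to \<open>U + 1\<close>, where the extra factor is 1 since
  \<open>mvar_upto U (Suc U) = 0\<close>, and clear the two products by their inverses, the complete
  series. Then insert \<open>word_series_zero\<close>.\<close>

lemma word_series_functional_equation: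
  assumes "1 \<le> l"
  shows "mcomplete {1..U} (q ^ l) * word_series U q l (Suc U) =
    mcomplete {1..U} 1 * (1 - mconst q + mconst q * word_series U q l (Suc U))"
proof -
  define A where "A = word_series U q l (Suc U)"
  define B where "B = word_series U q l 0"
  define H where "H = (\<lambda>c. mcomplete {1..U} c :: (nat, real) mseries)"
  define E where "E = (\<lambda>c. \<Prod>u=1..U. 1 - mconst c * mvar u :: (nat, real) mseries)"
  have HE: "H c * E c = 1" for c unfolding H_def E_def by (rule mcomplete_mult_prod) simp
  have "A * E 1 = E (q ^ l) * B"
  proof -
    have E: "(\<Prod>u=1..U. 1 - mconst c * mvar_upto U u) = E c" for c
      unfolding E_def by (rule prod.cong) (simp_all add: mvar_upto_def)
    have "mvar_upto U (Suc U) = 0" by (simp add: mvar_upto_def)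
    then have "(\<Prod>u=1..Suc U. 1 - mvar_upto U u) = E 1" using E[of 1] by simp
    moreover have "(\<Prod>u=1..<Suc U. 1 - mconst (q ^ l) * mvar_upto U u) = E (q ^ l)"
      using E by (simp only: atLeastLessThanSuc_atLeastAtMost)
    ultimately show ?thesis
      using word_series_product[OF assms, of U q "Suc U"] by (simp only: A_def B_def)
  qed
  then have "H 1 * H (q ^ l) * (A * E 1) = H 1 * H (q ^ l) * (E (q ^ l) * B)" by simp
  moreover have "H 1 * H (q ^ l) * (A * E 1) = (H 1 * E 1) * (H (q ^ l) * A)" by (simp only: ac_simps)
  moreover have "H 1 * H (q ^ l) * (E (q ^ l) * B) = (H (q ^ l) * E (q ^ l)) * (H 1 * B)"
    by (simp only: ac_simps)
  ultimately have "H (q ^ l) * A = H 1 * B" by (simp add: HE)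
  then show ?thesis using word_series_zero[OF assms, of U q] by (simp add: A_def B_def H_def)
qed

section \<open>Symmetry\<close>

text \<open>The substitution exchanges the two complete series, so the same \<open>D\<close>
  satisfies \<open>D * A q = (1 - t) * H 1\<close> and \<open>D * A' = (1 - t) * H (q ^ l)\<close>.
  Multiplied by \<open>D\<close>, the claim becomes a polynomial identity in \<open>t\<close> and
  the complete series; \<open>D\<close> cancels because its constant term is
  \<open>1 - q\<close>.\<close>

lemma word_series_reciprocal:
  fixes U l :: nat and q :: real
  assumes "1 \<le> l" "q \<noteq> 0" "q \<noteq> 1"
  defines "A \<equiv> \<lambda>q. word_series U q l (Suc U)"
    and "H \<equiv> \<lambda>c. mcomplete {1..U} c"
  shows "mconst q * mconst q * (H 1 * A q - H 1) - (H (q ^ l) * mscale (q ^ l) (A (1 / q)) - H (q ^ l)) =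
    mconst q * (H (q ^ l) - H 1)"
proof -
  define t :: "(nat, real) mseries" where "t = mconst q"
  define A' where "A' = mscale (q ^ l) (A (1 / q))"
  define D where "D = H (q ^ l) - t * H 1"
  have D: "D * A q = (1 - t) * H 1"
    using word_series_functional_equation[OF assms(1), of U q]
    by (simp add: D_def A_def H_def t_def algebra_simps)
  have "mscale (q ^ l) (H ((1 / q) ^ l) * A (1 / q)) =
      mscale (q ^ l) (H 1 * (1 - mconst (1 / q) + mconst (1 / q) * A (1 / q)))"
    using word_series_functional_equation[OF assms(1), of U "1 / q"] by (simp add: A_def H_def)
  moreover have "1 - mconst (1 / q) + mconst (1 / q) * A (1 / q) =
      mconst (1 / q) * (t - 1 + A (1 / q))"
    using assms(2) by (simp add: t_def algebra_simps flip: mconst_mult)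
  ultimately have "H 1 * A' = H (q ^ l) * (mconst (1 / q) * (t - 1 + A'))"
    using assms(2)
    by (simp add: A'_def H_def t_def mscale_mult mscale_mcomplete mscale_add mscale_diff
        flip: power_mult_distrib)
  then have "t * (H 1 * A') = H (q ^ l) * (t * mconst (1 / q) * (t - 1 + A'))"
    by (simp add: ac_simps)
  also have "t * mconst (1 / q) = 1" using assms(2) by (simp add: t_def flip: mconst_mult)
  finally have D': "D * A' = (1 - t) * H (q ^ l)" by (simp add: D_def algebra_simps)
  have "D * (t * t * (H 1 * A q - H 1) - (H (q ^ l) * A' - H (q ^ l)) - t * (H (q ^ l) - H 1)) =
      t * t * H 1 * (D * A q) - t * t * H 1 * D - H (q ^ l) * (D * A') + H (q ^ l) * D
        - t * (H (q ^ l) - H 1) * D"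
    by (simp add: algebra_simps)
  also have "\<dots> = 0" unfolding D D' by (simp add: D_def algebra_simps)
  finally have "D * (t * t * (H 1 * A q - H 1) - (H (q ^ l) * A' - H (q ^ l)) - t * (H (q ^ l) - H 1)) = 0" .
  moreover have "mcoeff D {#} \<noteq> 0" using assms(3) by (simp add: D_def H_def t_def mcoeff_mcomplete)
  ultimately have "t * t * (H 1 * A q - H 1) - (H (q ^ l) * A' - H (q ^ l)) - t * (H (q ^ l) - H 1) = 0"
    by (rule mseries_mult_eq_0D)
  then show ?thesis by (simp add: t_def A'_def)
qed

section \<open>Extraction of coefficients\<close>

text \<open>The coefficient of \<open>t ^ k\<close> and of the monomial \<open>alpha\<close> in
  \<open>H (A - 1)\<close>. Strictness of the inclusion removes the empty word, matching the range
  \<open>i < n\<close> of the theorem.\<close>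

definition proper_count :: "nat \<Rightarrow> nat \<Rightarrow> nat multiset \<Rightarrow> nat \<Rightarrow> int" where
  "proper_count l v alpha k =
    (\<Sum>B\<in>{B. B \<subset># alpha}. int (card {w \<in> words l v (alpha - B). word_k l w = k}))"

lemma word_k_le:
  assumes "w \<in> words l v g"
  shows "word_k l w \<le> l * size g"
proof -
  have "kcontrib l x \<le> l" if "valid_letter l x" for x using that by (cases x) auto
  then have "(\<forall>x\<in>set w. valid_letter l x) \<Longrightarrow> word_k l w \<le> l * length w" for w
    by (induction w) (auto simp: word_k_def intro: add_mono)
  moreover have "length w = size g" using assms by (auto simp: words_def)
  ultimately show ?thesis using assms by (auto simp: words_def)
qed

lemma word_gf_eq_sum_card:
  fixes q :: real
  assumes "l * size g \<le> N"
  shows "word_gf q l v g = (\<Sum>k\<le>N. card {w \<in> words l v g. word_k l w = k} * q ^ k)"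
proof -
  have "(\<Sum>k\<le>N. card {w \<in> words l v g. word_k l w = k} * q ^ k) =
      (\<Sum>k\<le>N. \<Sum>w\<in>{w \<in> words l v g. word_k l w = k}. q ^ word_k l w)"
    by (intro sum.cong) auto
  also have "\<dots> = word_gf q l v g" unfolding word_gf_def
    by (rule sum.group) (use word_k_le assms in \<open>fastforce+\<close>)
  finally show ?thesis ..
qed

lemma sum_word_gf_proper:
  fixes q :: real
  assumes "N = l * size alpha"
  shows "(\<Sum>B\<in>{B. B \<subseteq># alpha}. word_gf q l v (alpha - B)) - 1 =
    (\<Sum>k\<le>N. of_int (proper_count l v alpha k) * q ^ k)"
proof -
  have "{B. B \<subseteq># alpha} = insert alpha {B. B \<subset># alpha}"
    by (auto simp: subset_mset.le_less)
  moreover have fin: "finite {B. B \<subset># alpha}"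
    by (rule finite_subset[OF _ finite_subset_mset[of alpha]]) auto
  moreover have "word_gf q l v {#} = 1" by (simp add: word_gf_def word_k_def)
  ultimately have "(\<Sum>B\<in>{B. B \<subseteq># alpha}. word_gf q l v (alpha - B)) - 1 =
      (\<Sum>B\<in>{B. B \<subset># alpha}. word_gf q l v (alpha - B))" by simp
  also have "\<dots> = (\<Sum>B\<in>{B. B \<subset># alpha}. \<Sum>k\<le>N.
      card {w \<in> words l v (alpha - B). word_k l w = k} * q ^ k)"
    by (intro sum.cong refl word_gf_eq_sum_card)
       (simp add: assms size_Diff_submset subset_mset.less_imp_le)
  also have "\<dots> = (\<Sum>k\<le>N. of_int (proper_count l v alpha k) * q ^ k)"
    unfolding proper_count_def by (subst sum.swap) (simp add: sum_distrib_right)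
  finally show ?thesis .
qed

text \<open>Read \<open>word_series_reciprocal\<close> at \<open>alpha\<close>. In the substituted
  product the powers of \<open>q ^ l\<close> from both factors combine to \<open>q ^ N\<close>,
  which turns \<open>(1 / q) ^ k\<close> into \<open>q ^ (N - k)\<close> and so reverses the list of
  coefficients.\<close>

lemma proper_count_polynomial_identity:
  fixes q :: real
  assumes "1 \<le> l" "set_mset alpha \<subseteq> {1..U}" "q \<noteq> 0" "q \<noteq> 1" and N: "N = l * size alpha"
  defines "p \<equiv> proper_count l (Suc U) alpha"
  shows "q ^ 2 * (\<Sum>k\<le>N. of_int (p k) * q ^ k) - (\<Sum>k\<le>N. of_int (p (N - k)) * q ^ k) = q * (q ^ N - 1)"
proof -
  define A where "A = (\<lambda>q. word_series U q l (Suc U))"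
  define H where "H = (\<lambda>c. mcomplete {1..U} c :: (nat, real) mseries)"
  define A' where "A' = mscale (q ^ l) (A (1 / q))"
  have qN: "(q ^ l) ^ size alpha = q ^ N" by (simp add: N power_mult)
  have sub: "set_mset B \<subseteq> {1..U}" "set_mset (alpha - B) \<subseteq> {1..U}" if "B \<subseteq># alpha" for B
    using that assms(2) by (meson set_mset_mono order_trans diff_subset_eq_self)+
  have A: "mcoeff (A x) (alpha - B) = word_gf x l (Suc U) (alpha - B)" if "B \<subseteq># alpha" for B x
    using sub[OF that] by (simp add: A_def word_series_def)
  have HA: "mcoeff (H 1 * A q - H 1) alpha = (\<Sum>k\<le>N. of_int (p k) * q ^ k)"
    using assms(2) A sub
    by (simp add: H_def mcoeff_mult mcoeff_mcomplete p_def flip: sum_word_gf_proper[OF N])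
  have "mcoeff (H (q ^ l) * A' - H (q ^ l)) alpha =
      (\<Sum>B\<in>{B. B \<subseteq># alpha}. q ^ N * word_gf (1 / q) l (Suc U) (alpha - B)) - q ^ N"
  proof -
    have "mcoeff (H (q ^ l)) B * mcoeff A' (alpha - B) = q ^ N * word_gf (1 / q) l (Suc U) (alpha - B)"
      if B: "B \<subseteq># alpha" for B
    proof -
      have "size B + size (alpha - B) = size alpha"
        using B by (metis size_union subset_mset.add_diff_inverse)
      then have "(q ^ l) ^ size B * (q ^ l) ^ size (alpha - B) = q ^ N"
        by (metis power_add qN)
      then show ?thesis using A[OF B] sub[OF B]
        by (simp add: H_def A'_def mcoeff_mcomplete flip: mult.assoc)
    qed
    then show ?thesis using assms(2) by (simp add: mcoeff_mult H_def mcoeff_mcomplete qN)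
  qed
  also have "\<dots> = q ^ N * ((\<Sum>B\<in>{B. B \<subseteq># alpha}. word_gf (1 / q) l (Suc U) (alpha - B)) - 1)"
    by (simp add: sum_distrib_left algebra_simps)
  also have "\<dots> = (\<Sum>k\<le>N. of_int (p k) * q ^ (N - k))"
    unfolding sum_word_gf_proper[OF N] sum_distrib_left p_def
    using assms(3) by (intro sum.cong) (simp_all add: power_diff power_one_over field_simps)
  also have "\<dots> = (\<Sum>k\<le>N. of_int (p (N - k)) * q ^ k)"
    by (rule sum.reindex_bij_witness[of _ "\<lambda>k. N - k" "\<lambda>k. N - k"]) auto
  finally have HA': "mcoeff (H (q ^ l) * A' - H (q ^ l)) alpha = (\<Sum>k\<le>N. of_int (p (N - k)) * q ^ k)" .
  have "mcoeff (mconst q * (mconst q * (H 1 * A q - H 1)) - (H (q ^ l) * A' - H (q ^ l))) alpha =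
      mcoeff (mconst q * (H (q ^ l) - H 1)) alpha"
    using word_series_reciprocal[OF assms(1,3,4), of U] by (simp add: A_def H_def A'_def mult.assoc)
  then have "q * (q * mcoeff (H 1 * A q - H 1) alpha) - mcoeff (H (q ^ l) * A' - H (q ^ l)) alpha =
      q * (q ^ N - 1)"
    using assms(2) qN by (simp add: H_def mcoeff_mcomplete del: mcoeff_diff) (simp add: mcoeff_mcomplete)
  then show ?thesis unfolding HA HA' by (simp add: power2_eq_square mult.assoc)
qed

lemma proper_count_symmetric:
  assumes "1 \<le> l" "set_mset alpha \<subseteq> {1..U}" "1 \<le> a" "1 \<le> b" "a + b = l * size alpha"
  shows "proper_count l (Suc U) alpha (a - 1) = proper_count l (Suc U) alpha (b - 1)"
proof -
  define N where "N = l * size alpha"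
  define p where "p = proper_count l (Suc U) alpha"
  \<comment> \<open>The coefficient of \<open>q ^ i\<close> in the difference of the two sides of
    the polynomial identity; the last two terms come from \<open>q * (q ^ N - 1)\<close>.\<close>
  define c :: "nat \<Rightarrow> real" where "c i = (if 2 \<le> i then of_int (p (i - 2)) else 0)
    - (if i \<le> N then of_int (p (N - i)) else 0)
    - (if i = N + 1 then 1 else 0) + (if i = 1 then 1 else 0)" for i
  have "(\<Sum>i\<le>N + 2. c i * q ^ i) = 0" if q: "q \<noteq> 0" "q \<noteq> 1" for q
  proof -
    have "(\<Sum>i\<le>N + 2. c i * q ^ i) =
        (\<Sum>i\<le>N + 2. if 2 \<le> i then of_int (p (i - 2)) * q ^ i else 0)
        - (\<Sum>i\<le>N + 2. if i \<le> N then of_int (p (N - i)) * q ^ i else 0)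
        - (\<Sum>i\<le>N + 2. if i = N + 1 then q ^ i else 0) + (\<Sum>i\<le>N + 2. if i = 1 then q ^ i else 0)"
      unfolding sum_subtractf[symmetric] sum.distrib[symmetric]
      by (intro sum.cong refl) (simp add: c_def algebra_simps)
    also have "(\<Sum>i\<le>N + 2. if 2 \<le> i then of_int (p (i - 2)) * q ^ i else 0) =
        (\<Sum>i\<in>{2..N + 2}. of_int (p (i - 2)) * q ^ i)"
      by (rule sum.mono_neutral_cong_right) auto
    also have "\<dots> = (\<Sum>k\<le>N. of_int (p k) * q ^ (k + 2))"
      by (rule sum.reindex_bij_witness[of _ "\<lambda>k. k + 2" "\<lambda>i. i - 2"])
        (auto dest!: le_Suc_ex)
    also have "\<dots> = q ^ 2 * (\<Sum>k\<le>N. of_int (p k) * q ^ k)"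
      unfolding sum_distrib_left power_add by (simp add: ac_simps)
    also have "(\<Sum>i\<le>N + 2. if i \<le> N then of_int (p (N - i)) * q ^ i else 0) =
        (\<Sum>k\<le>N. of_int (p (N - k)) * q ^ k)"
      by (rule sum.mono_neutral_cong_right) auto
    also have "(\<Sum>i\<le>N + 2. if i = N + 1 then q ^ i else 0) = q ^ (N + 1)"
      by (subst sum.delta) auto
    also have "(\<Sum>i\<le>N + 2. if i = 1 then q ^ i else 0) = q"
      by (subst sum.delta) auto
    finally have expand: "(\<Sum>i\<le>N + 2. c i * q ^ i) = q ^ 2 * (\<Sum>k\<le>N. of_int (p k) * q ^ k)
      - (\<Sum>k\<le>N. of_int (p (N - k)) * q ^ k) - q ^ (N + 1) + q" .
    show ?thesis
      unfolding expand using proper_count_polynomial_identity[OF assms(1,2) q N_def]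
      by (simp add: p_def algebra_simps)
  qed
  then have "UNIV - {0, 1} \<subseteq> {q. (\<Sum>i\<le>N + 2. c i * q ^ i) = 0}" by blast
  moreover have "infinite (UNIV - {0, 1 :: real})" by (simp add: infinite_UNIV_char_0)
  ultimately have "infinite {q. (\<Sum>i\<le>N + 2. c i * q ^ i) = 0}" by (rule infinite_super)
  then have "\<forall>i\<le>N + 2. c i = 0" using polyfun_finite_roots[of c "N + 2"] by blast
  \<comment> \<open>At \<open>i = a + 1\<close> the two sums contribute \<open>p (a - 1)\<close> and
    \<open>p (b - 1)\<close>. Since \<open>a\<close> and \<open>b\<close> are positive,
    \<open>i\<close> avoids the exceptional exponents 1 and \<open>N + 1\<close>.\<close>
  then have "c (a + 1) = 0" using assms(5) by (simp add: N_def)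
  moreover have "a + 1 \<le> N" "N - (a + 1) = b - 1" "2 \<le> a + 1" "a + 1 - 2 = a - 1"
    using assms by (simp_all add: N_def)
  ultimately show ?thesis using assms(3) by (simp add: c_def flip: p_def)
qed

text \<open>A submultiset \<open>B\<close> is met by \<open>hcomp i\<close> only for
  \<open>i = size B\<close>, so \<open>i < n\<close> selects the proper submultisets of
  \<open>alpha\<close>. If \<open>alpha\<close> has the wrong degree or contains the index 0, every
  product vanishes.\<close>

lemma sum_hcomp_mult_Qnk:
  assumes "\<forall>u\<in>#alpha. u < v"
  shows "(\<Sum>i<n. ser_mult (hcomp i) (Qnk l (n - i) k) alpha) =
    (if size alpha = n \<and> 0 \<notin># alpha then proper_count l v alpha k else 0)"
proof (cases "size alpha = n \<and> 0 \<notin># alpha")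
  case True
  have sub: "{B. B \<subset># alpha} \<subseteq> {B. B \<subseteq># alpha}" by auto
  have "(\<Sum>i<n. ser_mult (hcomp i) (Qnk l (n - i) k) alpha) =
      (\<Sum>B\<in>{B. B \<subseteq># alpha}. \<Sum>i<n. hcomp i B * Qnk l (n - i) k (alpha - B))"
    unfolding ser_mult_def by (rule sum.swap)
  also have "\<dots> = proper_count l v alpha k" unfolding proper_count_def
  proof (rule sum.mono_neutral_cong_right[OF finite_subset_mset sub])
    show "\<forall>B\<in>{B. B \<subseteq># alpha} - {B. B \<subset># alpha}. (\<Sum>i<n. hcomp i B * Qnk l (n - i) k (alpha - B)) = 0"
      using True by (auto simp: hcomp_def subset_mset.le_less)
  next
    fix B assume "B \<in> {B. B \<subset># alpha}"
    then have B: "B \<subseteq># alpha" "size B < n"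
      using True by (auto simp: mset_subset_size subset_mset.less_imp_le)
    then have "0 \<notin># B" and small: "\<forall>u\<in>#alpha - B. u < v"
      using True assms by (auto dest: mset_subset_eqD in_diffD)
    then have "(\<Sum>i<n. hcomp i B * Qnk l (n - i) k (alpha - B)) =
        (\<Sum>i<n. if i = size B then Qnk l (n - i) k (alpha - B) else 0)"
      by (intro sum.cong) (auto simp: hcomp_def)
    also have "\<dots> = Qnk l (n - size B) k (alpha - B)" using B by simp
    also have "\<dots> = int (card {w \<in> words l v (alpha - B). word_k l w = k})"
      using Qnk_eq_card_words[OF small] B True by (simp add: size_Diff_submset)
    finally show "(\<Sum>i<n. hcomp i B * Qnk l (n - i) k (alpha - B)) =
        int (card {w \<in> words l v (alpha - B). word_k l w = k})" .
  qed
  finally show ?thesis using True by simp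
next
  case False
  have "hcomp i B * Qnk l (n - i) k (alpha - B) = 0" if "i < n" "B \<subseteq># alpha" for i B
  proof (rule ccontr)
    assume nz: "hcomp i B * Qnk l (n - i) k (alpha - B) \<noteq> 0"
    have small: "\<forall>u\<in>#alpha - B. u < v" using assms by (auto dest: in_diffD)
    have B: "size B = i" "0 \<notin># B" using nz by (auto simp: hcomp_def split: if_splits)
    have "size (alpha - B) = n - i" "words l v (alpha - B) \<noteq> {}"
      using nz Qnk_eq_card_words[OF small, of l "n - i" k] by (auto split: if_splits)
    then have "size alpha = n" "0 \<notin># alpha"
      using B that words_zero[of "alpha - B" l v]
      by (auto simp: size_Diff_submset size_mset_mono) (metis mset_subset_eq_exists_conv add_diff_cancel_left' union_iff)+
    then show False using False by simp
  qed
  then have "(\<Sum>i<n. ser_mult (hcomp i) (Qnk l (n - i) k) alpha) = 0"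
    unfolding ser_mult_def by (intro sum.neutral ballI) simp
  then show ?thesis unfolding if_not_P[OF False] .
qed

theorem theorem1p2:
  fixes l n a b :: nat
  assumes "1 \<le> l" and "1 \<le> n" and "1 \<le> a" and "1 \<le> b" and "a + b = l * n"
  shows "\<forall>alpha. (\<Sum>i<n. ser_mult (hcomp i) (Qnk l (n - i) (a - 1)) alpha)
                 = (\<Sum>i<n. ser_mult (hcomp i) (Qnk l (n - i) (b - 1)) alpha)"
proof
  fix alpha :: "nat multiset"
  \<comment> \<open>A single monomial involves finitely many variables, so \<open>U\<close>
    variables suffice for its coefficient, and \<open>Suc U\<close> acts as infinity.\<close>
  obtain U where U: "\<forall>u\<in>#alpha. u \<le> U"
    using finite_nat_set_iff_bounded_le[of "set_mset alpha"] by auto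
  then have small: "\<forall>u\<in>#alpha. u < Suc U" by auto
  have "proper_count l (Suc U) alpha (a - 1) = proper_count l (Suc U) alpha (b - 1)"
    if "size alpha = n" "0 \<notin># alpha"
  proof (rule proper_count_symmetric)
    show "set_mset alpha \<subseteq> {1..U}"
      using U that(2) by (metis atLeastAtMost_iff subsetI One_nat_def Suc_leI neq0_conv)
  qed (use assms that in auto)
  then show "(\<Sum>i<n. ser_mult (hcomp i) (Qnk l (n - i) (a - 1)) alpha) =
      (\<Sum>i<n. ser_mult (hcomp i) (Qnk l (n - i) (b - 1)) alpha)"
    by (simp add: sum_hcomp_mult_Qnk[OF small])
qed

end
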